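(* Let $\mathcal{H}\mathrm{ilb}^n_{p(t)}$ be the Hilbert scheme parametrizing subschemes of $\mathbb{P}^n$ with Hilbert polynomial $p(t)$, whose Gotzmann number is $r$. Let $I$ and $J$ be two Borel-fixed ideals in $\mathcal{H}\mathrm{ilb}^n_{p(t)}$, and let $x^\alpha\in\mathfrak{m}\{I_r\}_i$ and $x^\beta\in\mathfrak{M}\{N(I)_r\}_i$ be such that the set of decreasing moves $\mathcal{F}_\alpha$ is Borel-consistent with respect to $x^\beta$. If $\{J_r\}=\big(\{I_r\}\cup\mathcal{F}_\alpha(x^\beta)\big)\setminus\mathcal{F}_\alpha(x^\alpha)$, then there is a rational curve $\mathcal{C}:\mathbb{P}^1\to\mathcal{H}\mathrm{ilb}^n_{p(t)}$ going through the points of $\mathcal{H}\mathrm{ilb}^n_{p(t)}$ defined by $I$ and $J$.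
   Context: $\mathbb{K}$ is an algebraically closed field of characteristic $0$, $\mathbb{K}[x]=\mathbb{K}[x_0,\ldots,x_n]$, $\mathbb{P}^n=\mathrm{Proj}\,\mathbb{K}[x]$, and $x^\alpha=x_n^{\alpha_n}\cdots x_0^{\alpha_0}$. The Gotzmann number $r$ of $p(t)$ is the best upper bound for the Castelnuovo–Mumford regularity of subschemes with Hilbert polynomial $p(t)$. "The ideal $I$ is in $\mathcal{H}\mathrm{ilb}^n_{p(t)}$" means that $\mathrm{Proj}\,\mathbb{K}[x]/I$ has Hilbert polynomial $p(t)$ and $I=I_{\ge r}$ is generated in degree $r$; the point defined by $I$ is that of $\mathrm{Proj}\,\mathbb{K}[x]/I$. A homogeneous ideal $I$ is Borel-fixed if it is monomial and for all monomials $x^\alpha\in I$, all $x_i\mid x^\alpha$ and all $j>i$, $x_j\frac{x^\alpha}{x_i}\in I$. $\mathcal{P}(n,r)$ is the set of monomials of degree $r$. Elementary moves: $\mathrm{e}^{-}_i(x^\alpha)=\frac{x_{i-1}}{x_i}x^\alpha$, admissible when $0<i\le n$ and $x_i\mid x^\alpha$; $\mathrm{e}^{+}_j(x^\alpha)=\frac{x_{j+1}}{x_j}x^\alpha$, admissible when $0\le j<n$ and $x_j\mid x^\alpha$. A composition of moves is regarded as multiplication by the corresponding Laurent monomial $x^\gamma$, and is admissible on $x^\alpha$ if $x^\gamma x^\alpha\in\mathbb{K}[x]$. A Borel set is a subset $B\subset\mathcal{P}(n,r)$ closed under all admissible $\mathrm{e}^{+}_j$; $N=\mathcal{P}(n,r)\setminus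 B$. For a Borel-fixed ideal $I$, $\{I_r\}$ is the Borel set of monomials of degree $r$ in $I$, and $\{N(I)_r\}=\mathcal{P}(n,r)\setminus\{I_r\}$. $\min x^\alpha=\min\{j: x_j\mid x^\alpha\}$; $B_j$ (resp. $N_j$) is the set of $x^\alpha\in B$ (resp. $N$) with $\min x^\alpha\ge j$. A monomial $x^\alpha$ is minimal in $B_j$ if $x^\alpha\in B_j$ and $\mathrm{e}^{-}_i(x^\alpha)\in N_j$ for all admissible $\mathrm{e}^{-}_i$ with $i>j$; $x^\beta$ is maximal in $N_j$ if $x^\beta\in N_j$ and $\mathrm{e}^{+}_i(x^\beta)\in B_j$ for all admissible $\mathrm{e}^{+}_i$. For $0\le j\le n-1$, $\mathfrak{m}(B_j)$ is the set of minimal elements of $B_j$ contained in $B_j\setminus B_{j+1}$, and $\mathfrak{M}(N_j)$ is the set of maximal elements of $N_j$ contained in $N_j\setminus N_{j+1}$; for $B=\{I_r\}$ they are denoted $\mathfrak{m}\{I_r\}_j$ and $\mathfrak{M}\{N(I)_r\}_j$. For $x^\alpha\in\mathfrak{m}(B_j)$ the family of decreasing moves with respect to $x^\alpha$ is $$\mathcal{F}_\alpha=\{F=(\mathrm{e}^{-}_{l_s})^{\lambda_s}\cdots(\mathrm{e}^{-}_{l_1})^{\lambda_1} : j\ge l_1>\cdots>l_s,\ F \text{ admissible on } x^\alpha,\ F(x^\alpha)\in B\}\cup\{\mathrm{id}\}.$$ For $x^\beta\in\mathfrak{M}(N_j)$, $\mathcal{F}_\alpha$ is Borel-consistent with respect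 to $x^\beta$ if every $F\in\mathcal{F}_\alpha$ is admissible on $x^\beta$ and $\mathrm{e}^{+}_i(F(x^\beta))\in B$ for all $F\in\mathcal{F}_\alpha$ and all admissible $\mathrm{e}^{+}_i$ with $i\ge j$. In this case $\mathcal{F}_\alpha(x^\alpha)=\{F(x^\alpha): F\in\mathcal{F}_\alpha\}$ and $\mathcal{F}_\alpha(x^\beta)=\{F(x^\beta): F\in\mathcal{F}_\alpha\}$. *)

theory Defs
  imports
    "HOL-Library.Poly_Mapping"
    "HOL-Library.Extended_Real"
    "HOL-Computational_Algebra.Polynomial"
    "HOL-Algebra.Ideal"
    "Jordan_Normal_Form.Determinant"
begin

section \<open>The polynomial ring $K[x_0,\ldots,x_n]$\<close>

text \<open>
  Monomials are exponent vectors.  Variables are indexed by all natural numbers, so that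
  $K[x_0,\ldots,x_n]$ is the subring of those polynomials that involve only $x_0,\ldots,x_n$.
\<close>

type_synonym mon = "nat \<Rightarrow>\<^sub>0 nat"
type_synonym 'k mpoly = "mon \<Rightarrow>\<^sub>0 'k"

definition mdeg :: "mon \<Rightarrow> nat" where
  "mdeg m = (\<Sum>i\<in>Poly_Mapping.keys m. Poly_Mapping.lookup m i)"

definition monomials :: "nat \<Rightarrow> nat \<Rightarrow> mon set" where
  "monomials n d = {m. Poly_Mapping.keys m \<subseteq> {..n} \<and> mdeg m = d}"

definition xpow :: "mon \<Rightarrow> 'k::field mpoly" where
  "xpow m = Poly_Mapping.single m 1"

definition polys :: "nat \<Rightarrow> 'k::field mpoly set" where
  "polys n = {f. \<forall>m\<in>Poly_Mapping.keys f. Poly_Mapping.keys m \<subseteq> {..n}}"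

definition poly_ring :: "nat \<Rightarrow> 'k::field mpoly ring" where
  "poly_ring n = \<lparr>carrier = polys n, monoid.mult = (*), one = 1, zero = 0, add = (+)\<rparr>"

definition forms :: "nat \<Rightarrow> nat \<Rightarrow> 'k::field mpoly set" where
  "forms n d = {f. Poly_Mapping.keys f \<subseteq> monomials n d}"

definition smult_mpoly :: "'k::field \<Rightarrow> 'k mpoly \<Rightarrow> 'k mpoly" where
  "smult_mpoly c f = Poly_Mapping.single 0 c * f"

global_interpretation mpoly: vector_space smult_mpoly
  by unfold_locales
    (simp_all add: smult_mpoly_def distrib_left distrib_right single_add mult_single
      flip: mult.assoc)

section \<open>Homogeneous ideals and closed subschemes of projective space\<close>

definition hom_component :: "nat \<Rightarrow> 'k::field mpoly \<Rightarrow> 'k mpoly" where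
  "hom_component d f =
    (\<Sum>m\<in>{m \<in> Poly_Mapping.keys f. mdeg m = d}. Poly_Mapping.single m (Poly_Mapping.lookup f m))"

definition homogeneous_ideal :: "nat \<Rightarrow> 'k::field mpoly set \<Rightarrow> bool" where
  "homogeneous_ideal n I \<longleftrightarrow>
    ideal I (poly_ring n) \<and> (\<forall>f\<in>I. \<forall>d. hom_component d f \<in> I)"

definition graded_part :: "nat \<Rightarrow> 'k::field mpoly set \<Rightarrow> nat \<Rightarrow> 'k mpoly set" where
  "graded_part n I d = I \<inter> forms n d"

definition truncation :: "nat \<Rightarrow> 'k::field mpoly set \<Rightarrow> 'k mpoly set" where
  "truncation r I = {f \<in> I. \<forall>m\<in>Poly_Mapping.keys f. r \<le> mdeg m}"

text \<open>Saturation with respect to the irrelevant ideal $(x_0,\ldots,x_n)$.\<close>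

definition saturation :: "nat \<Rightarrow> 'k::field mpoly set \<Rightarrow> 'k mpoly set" where
  "saturation n I = {f \<in> polys n. \<exists>k. \<forall>m\<in>monomials n k. xpow m * f \<in> I}"

text \<open>
  Closed subschemes of $P^n$ correspond bijectively to saturated homogeneous ideals (the empty
  subscheme to the unit ideal), and are represented by them.  For an arbitrary homogeneous ideal
  $I$, the subscheme Proj $K[x]/I$ is represented by \<open>saturation n I\<close>.
\<close>

definition closed_subscheme :: "nat \<Rightarrow> 'k::field mpoly set \<Rightarrow> bool" where
  "closed_subscheme n X \<longleftrightarrow> homogeneous_ideal n X \<and> saturation n X = X"

text \<open>The dimension of the degree \<open>t\<close> part of $K[x]/I$.\<close>

definition hilbert_function :: "nat \<Rightarrow> 'k::field mpoly set \<Rightarrow> nat \<Rightarrow> nat" where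
  "hilbert_function n I t = mpoly.dim (forms n t :: 'k mpoly set) - mpoly.dim (graded_part n I t)"

definition has_hilbert_poly :: "nat \<Rightarrow> 'k::field mpoly set \<Rightarrow> rat poly \<Rightarrow> bool" where
  "has_hilbert_poly n I p \<longleftrightarrow>
    (\<forall>\<^sub>F t in sequentially. of_nat (hilbert_function n I t) = poly p (of_nat t))"

section \<open>Castelnuovo--Mumford regularity and the Gotzmann number\<close>

text \<open>
  Cohomology of the twists of the ideal sheaf $\mathcal{I}_X$ is computed by the Cech complex of
  the standard affine cover $D(x_0),\ldots,D(x_n)$.  For a nonempty \<open>S \<subseteq> {..n}\<close>, the sections
  of $\mathcal{I}_X(d)$ over the intersection of the $D(x_i)$ with \<open>i \<in> S\<close> are the elements of
  degree $d$ of the localization of $I$ at $\prod_{i\in S} x_i$, that is, the Laurent polynomials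
  $f/(\prod_{i\in S} x_i)^k$ with \<open>f \<in> I\<close> homogeneous of degree $d + k|S|$.
\<close>

type_synonym 'k laurent = "(nat \<Rightarrow>\<^sub>0 int) \<Rightarrow>\<^sub>0 'k"

definition int_exp :: "mon \<Rightarrow> (nat \<Rightarrow>\<^sub>0 int)" where
  "int_exp m = Poly_Mapping.map int m"

definition to_laurent :: "'k::field mpoly \<Rightarrow> 'k laurent" where
  "to_laurent f =
    (\<Sum>m\<in>Poly_Mapping.keys f. Poly_Mapping.single (int_exp m) (Poly_Mapping.lookup f m))"

definition cech_sections :: "nat \<Rightarrow> 'k::field mpoly set \<Rightarrow> int \<Rightarrow> nat set \<Rightarrow> 'k laurent set" where
  "cech_sections n I d S =
    {Poly_Mapping.single (\<Sum>i\<in>S. Poly_Mapping.single i (- int k)) 1 * to_laurent f | k e f.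
      f \<in> graded_part n I e \<and> int e = d + int (k * card S)}"

text \<open>Cech \<open>q\<close>-cochains are families indexed by the subsets of \<open>{..n}\<close> with \<open>q + 1\<close> elements.\<close>

definition cech_cochain ::
    "nat \<Rightarrow> 'k::field mpoly set \<Rightarrow> int \<Rightarrow> nat \<Rightarrow> (nat set \<Rightarrow> 'k laurent) \<Rightarrow> bool" where
  "cech_cochain n I d q c \<longleftrightarrow>
    (\<forall>S. S \<subseteq> {..n} \<and> card S = q + 1 \<longrightarrow> c S \<in> cech_sections n I d S)"

definition cech_diff :: "(nat set \<Rightarrow> 'k::field laurent) \<Rightarrow> nat set \<Rightarrow> 'k laurent" where
  "cech_diff c S = (\<Sum>s\<in>S. (- 1) ^ card {t\<in>S. t < s} * c (S - {s}))"

text \<open>$H^q(P^n, \mathcal{I}_X(d)) = 0$, for \<open>q \<ge> 1\<close>.\<close>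

definition cohomology_vanishes :: "nat \<Rightarrow> 'k::field mpoly set \<Rightarrow> int \<Rightarrow> nat \<Rightarrow> bool" where
  "cohomology_vanishes n I d q \<longleftrightarrow>
    (\<forall>c. cech_cochain n I d q c \<and>
        (\<forall>S. S \<subseteq> {..n} \<and> card S = q + 2 \<longrightarrow> cech_diff c S = 0) \<longrightarrow>
      (\<exists>b. cech_cochain n I d (q - 1) b \<and>
        (\<forall>S. S \<subseteq> {..n} \<and> card S = q + 1 \<longrightarrow> c S = cech_diff b S)))"

definition m_regular :: "nat \<Rightarrow> 'k::field mpoly set \<Rightarrow> int \<Rightarrow> bool" where
  "m_regular n I m \<longleftrightarrow> (\<forall>q\<ge>1. cohomology_vanishes n I (m - int q) q)"

text \<open>
  The regularity of a subscheme is that of its ideal sheaf.  It is extended-real-valued because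
  the zero sheaf is \<open>m\<close>-regular for every \<open>m\<close>.
\<close>

definition cm_regularity :: "nat \<Rightarrow> 'k::field mpoly set \<Rightarrow> ereal" where
  "cm_regularity n X = (INF m\<in>{m. m_regular n X m}. ereal (of_int m))"

definition hilb :: "nat \<Rightarrow> rat poly \<Rightarrow> 'k::field mpoly set set" where
  "hilb n p = {X. closed_subscheme n X \<and> has_hilbert_poly n X p}"

definition gotzmann_number :: "'k::field itself \<Rightarrow> nat \<Rightarrow> rat poly \<Rightarrow> ereal" where
  "gotzmann_number _ n p = (SUP X\<in>(hilb n p :: 'k mpoly set set). cm_regularity n X)"

section \<open>Rational curves on the Hilbert scheme\<close>

definition ideal_in_hilb :: "nat \<Rightarrow> rat poly \<Rightarrow> nat \<Rightarrow> 'k::field mpoly set \<Rightarrow> bool" where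
  "ideal_in_hilb n p r I \<longleftrightarrow>
    homogeneous_ideal n I \<and> has_hilbert_poly n I p \<and>
    I = truncation r I \<and> I = Idl\<^bsub>poly_ring n\<^esub> (graded_part n I r)"

definition hilb_point :: "nat \<Rightarrow> 'k::field mpoly set \<Rightarrow> 'k mpoly set" where
  "hilb_point n I = saturation n I"

text \<open>
  If $r$ is the Gotzmann number of $p(t)$, the Hilbert scheme is embedded as a closed subscheme
  in the Grassmannian of subspaces of codimension $p(r)$ of $K[x]_r$ by sending $X$ to the degree
  $r$ part of its saturated ideal, and the Grassmannian is embedded in a projective space by the
  Pluecker coordinates.  Here \<open>plucker_coords n r V\<close> consists of all the vectors of homogeneous
  Pluecker coordinates of a subspace \<open>V\<close> of $K[x]_r$: the coordinate with index \<open>ms\<close>, a list of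
  \<open>dim V\<close> monomials of degree \<open>r\<close>, is the minor on the columns \<open>ms\<close> of the matrix of
  coefficients of a basis of \<open>V\<close>.  The lists \<open>ms\<close> are not required to be increasing; the additional
  coordinates are, up to sign, repetitions of other coordinates, or zero.
\<close>

definition plucker_coords ::
    "nat \<Rightarrow> nat \<Rightarrow> 'k::field mpoly set \<Rightarrow> (mon list \<Rightarrow> 'k) set" where
  "plucker_coords n r V =
    {(\<lambda>ms. if set ms \<subseteq> monomials n r \<and> length ms = length bs
           then c * det (mat (length bs) (length bs) (\<lambda>(i, j). Poly_Mapping.lookup (bs ! i) (ms ! j)))
           else 0) | c bs.
      c \<noteq> 0 \<and> distinct bs \<and> \<not> mpoly.dependent (set bs) \<and> mpoly.span (set bs) = V}"

text \<open>The points of $P^1$ are the classes of nonzero pairs up to scaling.\<close>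

definition proj_line :: "('k::field \<times> 'k) set set" where
  "proj_line = {{(c * a, c * b) | c. c \<noteq> 0} | a b. (a, b) \<noteq> (0, 0)}"

definition binary_form :: "nat \<Rightarrow> (nat \<Rightarrow> 'k::field) \<Rightarrow> 'k \<times> 'k \<Rightarrow> 'k" where
  "binary_form d g = (\<lambda>(u, v). \<Sum>k\<le>d. g k * u ^ k * v ^ (d - k))"

text \<open>
  Since $P^1$ is reduced and $K$ is algebraically closed, a morphism from $P^1$ to the Hilbert
  scheme is a map to its $K$-points which, in the projective embedding above, is given by
  homogeneous polynomials of the same degree without common zeros in some Zariski open
  neighbourhood \<open>U\<close> of any given point.  The nonempty Zariski open subsets of $P^1$ are the cofinite
  ones.  That the forms \<open>G\<close> have no common zeros in \<open>U\<close> is implied, as the elements of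
  \<open>plucker_coords\<close> are nonzero.
\<close>

definition morphism_to_hilb ::
    "nat \<Rightarrow> rat poly \<Rightarrow> nat \<Rightarrow> (('k::field \<times> 'k) set \<Rightarrow> 'k mpoly set) \<Rightarrow> bool" where
  "morphism_to_hilb n p r C \<longleftrightarrow>
    C ` proj_line \<subseteq> hilb n p \<and>
    (\<forall>P\<in>proj_line. \<exists>U d G.
      P \<in> U \<and> U \<subseteq> proj_line \<and> finite (proj_line - U) \<and>
      (\<forall>Q\<in>U. \<forall>y\<in>Q.
        (\<lambda>ms. binary_form d (G ms) y) \<in> plucker_coords n r (graded_part n (C Q) r)))"

definition rational_curve ::
    "nat \<Rightarrow> rat poly \<Rightarrow> nat \<Rightarrow> (('k::field \<times> 'k) set \<Rightarrow> 'k mpoly set) \<Rightarrow> bool" where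
  "rational_curve n p r C \<longleftrightarrow>
    morphism_to_hilb n p r C \<and> (\<exists>P\<in>proj_line. \<exists>Q\<in>proj_line. C P \<noteq> C Q)"

section \<open>Borel-fixed ideals and elementary moves\<close>

definition monomial_ideal :: "nat \<Rightarrow> 'k::field mpoly set \<Rightarrow> bool" where
  "monomial_ideal n I \<longleftrightarrow>
    (\<exists>A. (\<forall>m\<in>A. Poly_Mapping.keys m \<subseteq> {..n}) \<and> I = Idl\<^bsub>poly_ring n\<^esub> (xpow ` A))"

definition borel_fixed :: "nat \<Rightarrow> 'k::field mpoly set \<Rightarrow> bool" where
  "borel_fixed n I \<longleftrightarrow>
    monomial_ideal n I \<and>
    (\<forall>m i j. xpow m \<in> I \<and> i \<in> Poly_Mapping.keys m \<and> i < j \<and> j \<le> n \<longrightarrow>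
      xpow (m - Poly_Mapping.single i 1 + Poly_Mapping.single j 1) \<in> I)"

definition mons_of :: "nat \<Rightarrow> 'k::field mpoly set \<Rightarrow> nat \<Rightarrow> mon set" where
  "mons_of n I r = {m \<in> monomials n r. xpow m \<in> I}"

text \<open>
  Compositions of moves are represented by the exponent vectors \<open>g\<close> of Laurent monomials.
  \<open>move g m\<close> is meaningful only if \<open>admissible g m\<close> holds, since \<open>nat\<close> truncates.
\<close>

definition admissible :: "(nat \<Rightarrow>\<^sub>0 int) \<Rightarrow> mon \<Rightarrow> bool" where
  "admissible g m \<longleftrightarrow> (\<forall>i. 0 \<le> Poly_Mapping.lookup (g + int_exp m) i)"

definition move :: "(nat \<Rightarrow>\<^sub>0 int) \<Rightarrow> mon \<Rightarrow> mon" where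
  "move g m = Poly_Mapping.map nat (g + int_exp m)"

definition e_minus :: "nat \<Rightarrow> (nat \<Rightarrow>\<^sub>0 int)" where
  "e_minus i = Poly_Mapping.single (i - 1) 1 - Poly_Mapping.single i 1"

definition e_plus :: "nat \<Rightarrow> (nat \<Rightarrow>\<^sub>0 int)" where
  "e_plus j = Poly_Mapping.single (j + 1) 1 - Poly_Mapping.single j 1"

definition minus_admissible :: "nat \<Rightarrow> nat \<Rightarrow> mon \<Rightarrow> bool" where
  "minus_admissible n i m \<longleftrightarrow> 0 < i \<and> i \<le> n \<and> i \<in> Poly_Mapping.keys m"

definition plus_admissible :: "nat \<Rightarrow> nat \<Rightarrow> mon \<Rightarrow> bool" where
  "plus_admissible n j m \<longleftrightarrow> j < n \<and> j \<in> Poly_Mapping.keys m"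

definition min_var :: "mon \<Rightarrow> nat" where
  "min_var m = Min (Poly_Mapping.keys m)"

definition part_ge :: "mon set \<Rightarrow> nat \<Rightarrow> mon set" where
  "part_ge B j = {m \<in> B. j \<le> min_var m}"

definition borel_minimal :: "nat \<Rightarrow> nat \<Rightarrow> mon set \<Rightarrow> nat \<Rightarrow> mon \<Rightarrow> bool" where
  "borel_minimal n r B j m \<longleftrightarrow>
    m \<in> part_ge B j \<and>
    (\<forall>i>j. minus_admissible n i m \<longrightarrow> move (e_minus i) m \<in> part_ge (monomials n r - B) j)"

definition borel_maximal :: "nat \<Rightarrow> nat \<Rightarrow> mon set \<Rightarrow> nat \<Rightarrow> mon \<Rightarrow> bool" where
  "borel_maximal n r B j m \<longleftrightarrow>
    m \<in> part_ge (monomials n r - B) j \<and>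
    (\<forall>i. plus_admissible n i m \<longrightarrow> move (e_plus i) m \<in> part_ge B j)"

definition min_elems :: "nat \<Rightarrow> nat \<Rightarrow> mon set \<Rightarrow> nat \<Rightarrow> mon set" where
  "min_elems n r B j = {m \<in> part_ge B j - part_ge B (j + 1). borel_minimal n r B j m}"

definition max_elems :: "nat \<Rightarrow> nat \<Rightarrow> mon set \<Rightarrow> nat \<Rightarrow> mon set" where
  "max_elems n r B j =
    {m \<in> part_ge (monomials n r - B) j - part_ge (monomials n r - B) (j + 1).
      borel_maximal n r B j m}"

text \<open>
  A product $(e^-_{l_s})^{\lambda_s} \cdots (e^-_{l_1})^{\lambda_1}$ with
  $j \ge l_1 > \cdots > l_s \ge 1$ is given by its exponents \<open>lam l\<close>, which are zero for the
  indices \<open>l\<close> in \<open>{1..j}\<close> that do not occur among the $l_k$.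
\<close>

definition decreasing_moves :: "mon set \<Rightarrow> nat \<Rightarrow> mon \<Rightarrow> (nat \<Rightarrow>\<^sub>0 int) set" where
  "decreasing_moves B j a =
    {g. (\<exists>lam :: nat \<Rightarrow> nat.
          g = (\<Sum>l\<in>{1..j}. Poly_Mapping.single (l - 1) (int (lam l)) -
                Poly_Mapping.single l (int (lam l)))) \<and>
        admissible g a \<and> move g a \<in> B} \<union> {0}"

definition borel_consistent :: "nat \<Rightarrow> mon set \<Rightarrow> nat \<Rightarrow> mon \<Rightarrow> mon \<Rightarrow> bool" where
  "borel_consistent n B j a b \<longleftrightarrow>
    (\<forall>g\<in>decreasing_moves B j a.
      admissible g b \<and>
      (\<forall>i\<ge>j. plus_admissible n i (move g b) \<longrightarrow> move (e_plus i) (move g b) \<in> B))"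

end

theory Submission
  imports Defs
begin

text \<open>
  Let $M$ and $N$ be the sets of monomials of degree at least $r$ in $I$ and in $J$.  Passing from
  $F(x^a)$ to $F(x^b)$ is multiplication by the Laurent monomial $x^b/x^a$, the same for all
  decreasing moves $F$.  The combinatorial heart of the proof is that multiplication by $x^b/x^a$
  maps \<open>M - N\<close> bijectively onto \<open>N - M\<close>, not only in degree $r$ but in all degrees
  (\<open>monomial_exchange_borel\<close>).  Indeed, every monomial of $M$ is in exactly one way a product
  $h w$ such that $h$ is a monomial of degree $r$ in $I$ and no variable of $w$ has a larger index
  than a variable of $h$ (the decomposition of Eliahou and Kervaire), and $h w$ lies outside $N$
  iff $h$ lies outside $J$, that is, iff $h = F(x^a)$ for some $F$.  As $x_i$ is the
  variable of lowest index in $x^a$ and in $x^b$, and $F$ moves only factors $x_0,\ldots,x_i$, the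
  lowest variables of $F(x^a)$ and $F(x^b)$ coincide, so that the same $w$ are allowed for both.

  Whenever such a bijection exists, $I$ and $J$ are joined by a pencil: for $(u : v)$ in $P^1$, take
  the polynomials with support in \<open>M \<union> N\<close> such that $u$ times the coefficient of $m x^b/x^a$
  is $v$ times the coefficient of $m$, for all $m$ in \<open>M - N\<close>.  They form a homogeneous ideal
  (\<open>ideal_exchange_ideal\<close>), equal to $I$ at $(1 : 0)$ and to $J$ at $(0 : 1)$.  It has the
  basis consisting of the monomials in \<open>M \<inter> N\<close> and the binomials $u m + v m x^b/x^a$ for $m$ in
  \<open>M - N\<close> (\<open>span_exchange_gen\<close>), so its Hilbert function does not depend on $(u : v)$.

  For Borel-fixed ideals, whether a monomial of degree at least $r$ belongs to $M$ or $N$ is not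
  affected by factors $x_0$.  Therefore $x_0$ is a nonzerodivisor modulo each ideal of the pencil in
  degrees at least $r$, and the ideal coincides with its saturation in these degrees
  (\<open>graded_part_saturation\<close>).  Hence every ideal of the pencil defines a point of the Hilbert
  scheme, whose Pluecker coordinates are the minors of the coefficient matrix of the above basis in
  degree $r$.  Each row of this matrix is constant or linear in $(u, v)$, so they are binary forms
  of the same degree (\<open>plucker_coords_exchange_ideal\<close>).
\<close>

abbreviation (input) lookup :: "('a \<Rightarrow>\<^sub>0 'b::zero) \<Rightarrow> 'a \<Rightarrow> 'b" where
  "lookup \<equiv> Poly_Mapping.lookup"

abbreviation (input) keys :: "('a \<Rightarrow>\<^sub>0 'b::zero) \<Rightarrow> 'a set" where
  "keys \<equiv> Poly_Mapping.keys"

abbreviation (input) single :: "'a \<Rightarrow> 'b \<Rightarrow> 'a \<Rightarrow>\<^sub>0 'b::zero" where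
  "single \<equiv> Poly_Mapping.single"

section \<open>Monomials and coefficients\<close>

text \<open>Exponents are natural numbers, so nothing cancels in a product of monomials.\<close>

lemma keys_add_mon: "keys (m + w) = keys m \<union> keys w" for m w :: mon
  by (auto simp: in_keys_iff lookup_add)

lemma mdeg_eq_sum:
  assumes "finite S" "keys m \<subseteq> S"
  shows "mdeg m = (\<Sum>i\<in>S. lookup m i)"
  unfolding mdeg_def using assms by (intro sum.mono_neutral_left) (auto simp: in_keys_iff)

lemma mdeg_add: "mdeg (m + w) = mdeg m + mdeg w"
proof -
  let ?S = "keys m \<union> keys w"
  have "mdeg (m + w) = (\<Sum>i\<in>?S. lookup (m + w) i)" "mdeg m = (\<Sum>i\<in>?S. lookup m i)"
    "mdeg w = (\<Sum>i\<in>?S. lookup w i)"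
    by (rule mdeg_eq_sum; auto simp: keys_add_mon)+
  then show ?thesis by (simp add: lookup_add sum.distrib)
qed

lemma mdeg_zero [simp]: "mdeg 0 = 0"
  by (simp add: mdeg_def)

lemma mdeg_eq_0_iff [simp]: "mdeg m = 0 \<longleftrightarrow> m = 0"
  by (auto simp: mdeg_def in_keys_iff intro!: poly_mapping_eqI)

lemma mdeg_single [simp]: "mdeg (single i k) = k"
  by (simp add: mdeg_def)

lemma finite_monomials: "finite (monomials n d)"
proof -
  let ?F = "{f. \<forall>i. (i \<in> {..n} \<longrightarrow> f i \<in> {..d}) \<and> (i \<notin> {..n} \<longrightarrow> f i = (0::nat))}"
  have "finite ?F" by (rule finite_set_of_finite_funs) auto
  moreover have "lookup ` monomials n d \<subseteq> ?F"
  proof (clarsimp simp: monomials_def, intro conjI impI)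
    fix m :: mon and i assume m: "keys m \<subseteq> {..n}"
    { assume "i \<le> n"
      then have "lookup m i \<le> (\<Sum>i\<in>{..n}. lookup m i)"
        by (intro member_le_sum) auto
      also have "\<dots> = mdeg m"
        using m by (intro mdeg_eq_sum[symmetric]) auto
      finally show "lookup m i \<le> mdeg m" . }
    { assume "\<not> i \<le> n" then show "lookup m i = 0" using m by (auto simp: in_keys_iff) }
  qed
  ultimately have "finite (lookup ` monomials n d)" by (rule rev_finite_subset)
  then show ?thesis by (rule finite_imageD) (simp add: inj_on_def poly_mapping.lookup_inject)
qed

lemma lookup_single_mult_add:
  "lookup (single w c * f) (w + m) = c * lookup f m" for f :: "'k::field mpoly"
proof -
  have "lookup (single w c * f) (w + m) = (\<Sum>l. (c when w = l) * (\<Sum>q. lookup f q when w + m = l + q))"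
    by (simp add: lookup_mult lookup_single)
  also have "\<dots> = (\<Sum>l. c * (\<Sum>q. lookup f q when w + m = l + q) when w = l)"
    by (rule Sum_any.cong) (simp add: when_def)
  also have "\<dots> = c * lookup f m"
    by simp
  finally show ?thesis .
qed

lemma lookup_single_mult_outside:
  fixes f :: "'k::field mpoly"
  assumes "\<nexists>m. m \<in> keys f \<and> m' = w + m"
  shows "lookup (single w c * f) m' = 0"
proof -
  have "m' \<notin> keys (single w c * f)"
    using keys_mult[of "single w c" f] assms by (auto split: if_splits)
  then show ?thesis by (simp add: in_keys_iff)
qed

lemma keys_xpow_mult: "keys (xpow w * f) = (\<lambda>m. w + m) ` keys f" for f :: "'k::field mpoly"
proof
  show "keys (xpow w * f) \<subseteq> (\<lambda>m. w + m) ` keys f"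
    using keys_mult[of "xpow w" f] by (auto simp: xpow_def)
  show "(\<lambda>m. w + m) ` keys f \<subseteq> keys (xpow w * f)"
    by (auto simp: xpow_def in_keys_iff lookup_single_mult_add)
qed

lemma mpoly_eq_sum_singles: "f = (\<Sum>m\<in>keys f. single m (lookup f m))" for f :: "'k::field mpoly"
  by (rule poly_mapping_eqI)
    (auto simp: lookup_sum lookup_single when_def in_keys_iff sum.delta)

lemma lookup_smult: "lookup (smult_mpoly c f) m = c * lookup f m"
  using lookup_single_mult_add[of 0 c f m] by (simp add: smult_mpoly_def)

lemma lookup_hom_component: "lookup (hom_component d f) m = (if mdeg m = d then lookup f m else 0)"
  by (auto simp: hom_component_def lookup_sum lookup_single when_def in_keys_iff sum.delta)

lemma hom_component_xpow_mult:
  "hom_component (mdeg w + d) (xpow w * f) = xpow w * hom_component d f" for f :: "'k::field mpoly"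
proof (rule poly_mapping_eqI)
  fix m'
  show "lookup (hom_component (mdeg w + d) (xpow w * f)) m' = lookup (xpow w * hom_component d f) m'"
  proof (cases "\<exists>m. m' = w + m")
    case True
    then show ?thesis
      by (auto simp: lookup_hom_component xpow_def lookup_single_mult_add mdeg_add)
  next
    case False
    then show ?thesis
      by (auto simp: lookup_hom_component xpow_def lookup_single_mult_outside)
  qed
qed

section \<open>Ideals of the polynomial ring\<close>

lemma polys_add: "f \<in> polys n \<Longrightarrow> g \<in> polys n \<Longrightarrow> f + g \<in> polys n"
  using keys_add[of f g] by (auto simp: polys_def)

lemma polys_mult: "f \<in> polys n \<Longrightarrow> g \<in> polys n \<Longrightarrow> f * g \<in> polys n"
  unfolding polys_def
proof clarify
  fix m i
  assume f: "\<forall>m\<in>keys f. keys m \<subseteq> {..n}" and g: "\<forall>m\<in>keys g. keys m \<subseteq> {..n}"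
    and "m \<in> keys (f * g)" and i: "i \<in> keys m"
  then obtain m1 m2 where "m = m1 + m2" "m1 \<in> keys f" "m2 \<in> keys g"
    using keys_mult[of f g] by blast
  with f g i show "i \<le> n"
    by (auto simp: keys_add_mon)
qed

lemma polys_uminus: "f \<in> polys n \<Longrightarrow> - f \<in> polys n"
  by (auto simp: polys_def in_keys_iff)

lemma polys_zero: "0 \<in> polys n" and polys_one: "1 \<in> polys n"
  by (auto simp: polys_def)

lemma polys_single: "keys m \<subseteq> {..n} \<Longrightarrow> single m c \<in> polys n"
  by (auto simp: polys_def)

lemma polys_xpow: "keys m \<subseteq> {..n} \<Longrightarrow> xpow m \<in> polys n"
  by (simp add: xpow_def polys_single)

lemma forms_subset_polys: "forms n d \<subseteq> polys n"
  by (auto simp: forms_def polys_def monomials_def)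

lemma ring_poly_ring: "ring (poly_ring n :: 'k::field mpoly ring)"
proof (intro ringI abelian_groupI monoidI)
  fix f :: "'k mpoly" assume "f \<in> carrier (poly_ring n)"
  then show "\<exists>g\<in>carrier (poly_ring n). g \<oplus>\<^bsub>poly_ring n\<^esub> f = \<zero>\<^bsub>poly_ring n\<^esub>"
    by (auto simp: poly_ring_def intro!: bexI[of _ "- f"] polys_uminus)
qed (auto simp: poly_ring_def polys_add polys_mult polys_zero polys_one add_ac mult_ac distrib_left)

text \<open>Every polynomial is a sum of terms, so being closed under multiplication by terms is enough.\<close>

lemma ideal_poly_ringI:
  fixes I :: "'k::field mpoly set"
  assumes sub: "I \<subseteq> polys n" and zero: "0 \<in> I"
    and add: "\<And>f g. f \<in> I \<Longrightarrow> g \<in> I \<Longrightarrow> f + g \<in> I"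
    and tmult: "\<And>f m c. f \<in> I \<Longrightarrow> keys m \<subseteq> {..n} \<Longrightarrow> single m c * f \<in> I"
  shows "ideal I (poly_ring n)"
proof -
  have sum: "(\<Sum>x\<in>X. F x) \<in> I" if "finite X" "\<And>x. x \<in> X \<Longrightarrow> F x \<in> I"
    for X and F :: "mon \<Rightarrow> 'k mpoly"
    using that by (induction X) (auto intro: zero add)
  have mult: "h * f \<in> I" if "f \<in> I" "h \<in> polys n" for f h
  proof -
    have "h * f = (\<Sum>m\<in>keys h. single m (lookup h m) * f)"
      by (subst mpoly_eq_sum_singles[of h]) (simp add: sum_distrib_right)
    also have "\<dots> \<in> I"
      using that by (intro sum tmult) (auto simp: polys_def)
    finally show ?thesis .
  qed
  show ?thesis
  proof (rule idealI[OF ring_poly_ring])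
    show "subgroup I (add_monoid (poly_ring n))"
    proof (rule group.subgroupI)
      show "group (add_monoid (poly_ring n :: 'k mpoly ring))"
        using ring.is_abelian_group[OF ring_poly_ring] abelian_group.a_group by blast
      fix f assume f: "f \<in> I"
      have "inv\<^bsub>add_monoid (poly_ring n)\<^esub> f = - f"
      proof (rule group.inv_equality)
        show "group (add_monoid (poly_ring n :: 'k mpoly ring))"
          using ring.is_abelian_group[OF ring_poly_ring] abelian_group.a_group by blast
      qed (use f sub in \<open>auto simp: poly_ring_def intro!: polys_uminus\<close>)
      moreover have "- f = single 0 (- 1) * f"
        by (simp add: single_uminus)
      ultimately show "inv\<^bsub>add_monoid (poly_ring n)\<^esub> f \<in> I"
        using tmult[OF f, of 0 "- 1"] by simp
    qed (use sub zero add in \<open>auto simp: poly_ring_def\<close>)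
  qed (use mult in \<open>auto simp: poly_ring_def mult.commute\<close>)
qed

lemma
  fixes I :: "'k::field mpoly set"
  assumes "ideal I (poly_ring n)"
  shows ideal_zero: "0 \<in> I"
    and ideal_add: "f \<in> I \<Longrightarrow> g \<in> I \<Longrightarrow> f + g \<in> I"
    and ideal_mult: "h \<in> polys n \<Longrightarrow> f \<in> I \<Longrightarrow> h * f \<in> I"
proof -
  interpret ideal I "poly_ring n" by fact
  show "0 \<in> I" "f \<in> I \<Longrightarrow> g \<in> I \<Longrightarrow> f + g \<in> I" "h \<in> polys n \<Longrightarrow> f \<in> I \<Longrightarrow> h * f \<in> I"
    using additive_subgroup.zero_closed[OF additive_subgroup_axioms]
      additive_subgroup.a_closed[OF additive_subgroup_axioms] I_l_closed
    by (auto simp: poly_ring_def)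
qed

lemma ideal_sum:
  fixes I :: "'k::field mpoly set"
  assumes "ideal I (poly_ring n)" "\<And>x. x \<in> X \<Longrightarrow> F x \<in> I"
  shows "(\<Sum>x\<in>X. F x) \<in> I"
  using assms(2) ideal_zero[OF assms(1)] ideal_add[OF assms(1)]
  by (induction X rule: infinite_finite_induct) auto

lemma subspace_graded_part:
  fixes I :: "'k::field mpoly set"
  assumes "ideal I (poly_ring n)"
  shows "mpoly.subspace (graded_part n I t)"
proof (rule mpoly.subspaceI)
  show "0 \<in> graded_part n I t"
    using ideal_zero[OF assms] by (simp add: graded_part_def forms_def)
  show "f + g \<in> graded_part n I t" if "f \<in> graded_part n I t" "g \<in> graded_part n I t" for f g
    using that ideal_add[OF assms] keys_add[of f g] by (auto simp: graded_part_def forms_def)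
  show "smult_mpoly c f \<in> graded_part n I t" if "f \<in> graded_part n I t" for c f
    using that ideal_mult[OF assms polys_single[of 0]]
    by (auto simp: graded_part_def forms_def in_keys_iff lookup_smult) (simp add: smult_mpoly_def)
qed

text \<open>The coefficients at the pivots form a diagonal matrix with nonzero diagonal.\<close>

lemma
  fixes g :: "mon \<Rightarrow> 'k::field mpoly"
  assumes "finite X"
    and pivot: "\<And>m m'. m \<in> X \<Longrightarrow> m' \<in> X \<Longrightarrow> lookup (g m) (piv m') = (if m = m' then \<kappa> m else 0)"
    and nonzero: "\<And>m. m \<in> X \<Longrightarrow> \<kappa> m \<noteq> 0"
  shows inj_on_if_pivots: "inj_on g X"
    and independent_if_pivots: "\<not> mpoly.dependent (g ` X)"
proof -
  show inj: "inj_on g X"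
  proof (rule inj_onI, rule ccontr)
    fix m m' assume "m \<in> X" "m' \<in> X" "g m = g m'" "m \<noteq> m'"
    then show False
      using pivot[of m m'] pivot[of m' m'] nonzero[of m'] by simp
  qed
  show "\<not> mpoly.dependent (g ` X)"
  proof (rule mpoly.independent_if_scalars_zero)
    fix c f
    assume zero: "(\<Sum>f\<in>g ` X. smult_mpoly (c f) f) = 0" and "f \<in> g ` X"
    then obtain m where m: "m \<in> X" "f = g m"
      by blast
    have "(\<Sum>m'\<in>X. c (g m') * lookup (g m') (piv m)) =
      lookup (\<Sum>f\<in>g ` X. smult_mpoly (c f) f) (piv m)"
      by (simp only: sum.reindex[OF inj] lookup_sum lookup_smult comp_apply)
    then have "(\<Sum>m'\<in>X. c (g m') * lookup (g m') (piv m)) = 0"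
      by (simp only: zero lookup_zero)
    also have "(\<Sum>m'\<in>X. c (g m') * lookup (g m') (piv m)) = (\<Sum>m'\<in>X. if m' = m then c f * \<kappa> m else 0)"
      using m by (intro sum.cong) (auto simp: pivot)
    also have "\<dots> = c f * \<kappa> m"
      using m \<open>finite X\<close> by simp
    finally show "c f = 0"
      using nonzero m by simp
  qed (use \<open>finite X\<close> in simp)
qed

section \<open>The pencil of ideals exchanging two sets of monomials\<close>

text \<open>
  These are the sets of monomials of degree at least $r$ in a monomial ideal for which $x_0$ is a
  nonzerodivisor on the quotient in degrees at least $r$.
\<close>

definition saturated_monomials :: "nat \<Rightarrow> nat \<Rightarrow> mon set \<Rightarrow> bool" where
  "saturated_monomials n r M \<longleftrightarrow>
    (\<forall>m\<in>M. keys m \<subseteq> {..n} \<and> r \<le> mdeg m) \<and>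
    (\<forall>m\<in>M. \<forall>w. keys w \<subseteq> {..n} \<longrightarrow> w + m \<in> M) \<and>
    (\<forall>m. r \<le> mdeg m \<and> single 0 1 + m \<in> M \<longrightarrow> m \<in> M)"

lemma saturated_monomials_cancel:
  assumes "saturated_monomials n r M" "r \<le> mdeg m" "single 0 k + m \<in> M"
  shows "m \<in> M"
  using assms(3)
proof (induction k)
  case (Suc k)
  have "single 0 1 + (single 0 k + m) = single 0 (1 + k) + m"
    by (simp only: add.assoc[symmetric] single_add)
  then have "single 0 1 + (single 0 k + m) \<in> M"
    using Suc.prems by simp
  moreover have "r \<le> mdeg (single 0 k + m)"
    using assms(2) by (simp add: mdeg_add)
  ultimately show ?case
    using Suc.IH assms(1) unfolding saturated_monomials_def by blast
qed simp

text \<open>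
  The monomial $m' = m x^b/x^a$ is given by \<open>m + b = m' + a\<close>, which avoids the truncated
  subtraction of exponents and treats $M$ and $N$ symmetrically.
\<close>

definition exchange_ideal ::
    "mon set \<Rightarrow> mon set \<Rightarrow> mon \<Rightarrow> mon \<Rightarrow> 'k \<Rightarrow> 'k \<Rightarrow> 'k::field mpoly set" where
  "exchange_ideal M N a b u v =
    {f. keys f \<subseteq> M \<union> N \<and>
      (\<forall>m\<in>M - N. \<forall>m'. m + b = m' + a \<longrightarrow> u * lookup f m' = v * lookup f m)}"

text \<open>
  The basis of the exchange ideal is indexed by $M$ for all $u$ and $v$.  The subtraction is exact
  where it is used, since $m x^b/x^a$ is a monomial for $m \in M - N$.
\<close>

definition exchange_gen ::
    "mon set \<Rightarrow> mon set \<Rightarrow> mon \<Rightarrow> mon \<Rightarrow> 'k \<Rightarrow> 'k \<Rightarrow> mon \<Rightarrow> 'k::field mpoly" where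
  "exchange_gen M N a b u v m =
    (if m \<in> M - N then single m u + single (m + b - a) v else xpow m)"

locale monomial_exchange =
  fixes n r :: nat and M N :: "mon set" and a b :: mon
  assumes M: "saturated_monomials n r M" and N: "saturated_monomials n r N"
    and mdeg_eq: "mdeg a = mdeg b"
    and partner_N: "\<And>m. m \<in> M - N \<Longrightarrow> \<exists>m'\<in>N - M. m + b = m' + a"
    and partner_M: "\<And>m'. m' \<in> N - M \<Longrightarrow> \<exists>m\<in>M - N. m + b = m' + a"
begin

lemma keys_subset: "m \<in> M \<union> N \<Longrightarrow> keys m \<subseteq> {..n}"
  and mdeg_ge: "m \<in> M \<union> N \<Longrightarrow> r \<le> mdeg m"
  and add_M: "m \<in> M \<Longrightarrow> keys w \<subseteq> {..n} \<Longrightarrow> w + m \<in> M"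
  and add_N: "m \<in> N \<Longrightarrow> keys w \<subseteq> {..n} \<Longrightarrow> w + m \<in> N"
  using M N unfolding saturated_monomials_def by blast+

lemma
  assumes "m \<in> M - N"
  shows partner_in: "m + b - a \<in> N - M" and partner_eq: "m + b = (m + b - a) + a"
  using partner_N[OF assms] by auto

lemma partner_unique: "m + b = m' + a \<Longrightarrow> m' = m + b - a" for m m' :: mon
  by simp

lemma partner_inj:
  assumes "m1 \<in> M - N" "m2 \<in> M - N" "m1 + b - a = m2 + b - a"
  shows "m1 = m2"
  using partner_eq[OF assms(1)] partner_eq[OF assms(2)] assms(3) by simp

lemma exchange_ideal_keys:
  assumes "f \<in> exchange_ideal M N a b u v" "m \<in> keys f"
  shows "keys m \<subseteq> {..n}" "r \<le> mdeg m"
  using assms keys_subset[of m] mdeg_ge[of m] unfolding exchange_ideal_def by auto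

text \<open>
  Let $m \in M - N$ and $m' = m x^b/x^a$.  If $m = w m_0$ with $m_0 \in M - N$, then
  $m' = w m_0'$, and the condition at $m$ on $x^w f$ is the condition at $m_0$ on $f$.  Otherwise
  $f$ cannot contribute to $m$ or $m'$: a monomial of $f$ dividing $m$ is not in $N$ since $m$ is
  not, so it is in \<open>M - N\<close>, contrary to the assumption; and one dividing $m'$ is in
  \<open>N - M\<close>, so the monomial of \<open>M - N\<close> that corresponds to it divides $m$.
\<close>

lemma ideal_exchange_ideal: "ideal (exchange_ideal M N a b u v) (poly_ring n)"
proof (rule ideal_poly_ringI)
  let ?W = "exchange_ideal M N a b u v"
  show "?W \<subseteq> polys n"
    using exchange_ideal_keys(1) unfolding polys_def by blast
  show "0 \<in> ?W"
    by (simp add: exchange_ideal_def)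
  show "f + g \<in> ?W" if "f \<in> ?W" "g \<in> ?W" for f g
    using that keys_add[of f g] by (fastforce simp: exchange_ideal_def lookup_add distrib_left)
  show "single w c * f \<in> ?W" if f: "f \<in> ?W" and w: "keys w \<subseteq> {..n}" for f w c
    unfolding exchange_ideal_def
  proof (intro CollectI conjI ballI allI impI)
    let ?g = "single w c * f"
    from f have f_keys: "keys f \<subseteq> M \<union> N"
      and f_eq: "\<And>m m'. m \<in> M - N \<Longrightarrow> m + b = m' + a \<Longrightarrow> u * lookup f m' = v * lookup f m"
      by (auto simp: exchange_ideal_def)
    show "keys ?g \<subseteq> M \<union> N"
    proof
      fix m assume "m \<in> keys ?g"
      then obtain m0 where "m = w + m0" "m0 \<in> keys f"
        using keys_mult[of "single w c" f] by (auto split: if_splits)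
      then show "m \<in> M \<union> N"
        using f_keys add_M add_N w by blast
    qed
    fix m m' assume m: "m \<in> M - N" and eq: "m + b = m' + a"
    have m': "m' \<in> N - M"
      using partner_in[OF m] partner_unique[OF eq] by simp
    show "u * lookup ?g m' = v * lookup ?g m"
    proof (cases "\<exists>m0\<in>M - N. m = w + m0")
      case True
      then obtain m0 where m0: "m0 \<in> M - N" "m = w + m0"
        by blast
      let ?m0' = "m0 + b - a"
      have "m' + a = w + ?m0' + a"
        using eq m0(2) partner_eq[OF m0(1)] by (simp add: add.assoc)
      then have "m' = w + ?m0'"
        by simp
      then show ?thesis
        using f_eq[OF m0(1) partner_eq[OF m0(1)]] m0(2)
        by (simp add: lookup_single_mult_add mult.left_commute)
    next
      \<comment> \<open>No monomial of \<open>f\<close> is carried to \<open>m\<close> or \<open>m'\<close>, so both sides vanish.\<close>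
      case False
      have 1: "m0 \<notin> keys f" if "m = w + m0" for m0
      proof
        assume "m0 \<in> keys f"
        then have "m0 \<in> N"
          using f_keys False that by blast
        then show False
          using add_N[of m0 w] w m that by auto
      qed
      have 2: "m0' \<notin> keys f" if "m' = w + m0'" for m0'
      proof
        assume "m0' \<in> keys f"
        then have "m0' \<in> N - M"
          using f_keys add_M[of m0' w] w m' that by auto
        then obtain m0 where "m0 \<in> M - N" "m0 + b = m0' + a"
          using partner_M by blast
        moreover from this that eq have "m + b = w + m0 + b"
          by (simp add: add.assoc)
        ultimately show False
          using False by simp
      qed
      have "lookup ?g m = 0" "lookup ?g m' = 0"
        by (rule lookup_single_mult_outside; use 1 2 in blast)+
      then show ?thesis
        by simp
    qed
  qed
qed

lemma homogeneous_exchange_ideal: "homogeneous_ideal n (exchange_ideal M N a b u v)"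
proof -
  have "hom_component d f \<in> exchange_ideal M N a b u v" if f: "f \<in> exchange_ideal M N a b u v" for d f
  proof -
    have "mdeg m = mdeg m'" if "m + b = m' + a" for m m'
      using arg_cong[OF that, of mdeg] mdeg_eq by (simp add: mdeg_add)
    then show ?thesis
      using f by (auto simp: exchange_ideal_def in_keys_iff lookup_hom_component split: if_splits)
  qed
  then show ?thesis
    by (simp add: homogeneous_ideal_def ideal_exchange_ideal)
qed

text \<open>
  Multiplication by $x_0^k$ preserves and reflects membership in $M$ and $N$ in degrees at least
  $r$, so it only translates the conditions that define the ideal.
\<close>

lemma exchange_ideal_cancel:
  assumes "xpow (single 0 k) * f \<in> exchange_ideal M N a b u v"
    and deg: "\<And>m. m \<in> keys f \<Longrightarrow> r \<le> mdeg m"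
  shows "f \<in> exchange_ideal M N a b u v"
  unfolding exchange_ideal_def
proof (intro CollectI conjI ballI allI impI)
  let ?x = "single 0 k :: mon"
  have lookup: "lookup (xpow ?x * f) (?x + m) = lookup f m" for m
    by (simp add: xpow_def lookup_single_mult_add)
  from assms(1) have keys: "keys (xpow ?x * f) \<subseteq> M \<union> N"
    and eq: "\<And>m m'. m \<in> M - N \<Longrightarrow> m + b = m' + a \<Longrightarrow>
      u * lookup (xpow ?x * f) m' = v * lookup (xpow ?x * f) m"
    by (auto simp: exchange_ideal_def)
  show "keys f \<subseteq> M \<union> N"
    using keys deg saturated_monomials_cancel[OF M, of _ k] saturated_monomials_cancel[OF N, of _ k]
    by (auto simp: keys_xpow_mult)
  fix m m' assume m: "m \<in> M - N" and "m + b = m' + a"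
  then have "?x + m + b = ?x + m' + a"
    by (simp add: add.assoc)
  moreover have "?x + m \<in> M - N"
    using m add_M[of m ?x] saturated_monomials_cancel[OF N, of m k] mdeg_ge[of m] by auto
  ultimately show "u * lookup f m' = v * lookup f m"
    using eq[of "?x + m" "?x + m'"] by (simp add: lookup)
qed

text \<open>
  The exponent of $x_0$ can be fixed to $r$: once the degrees are at least $r$, further factors
  $x_0$ can be cancelled.
\<close>

lemma saturation_exchange_ideal:
  "saturation n (exchange_ideal M N a b u v) =
    {f \<in> polys n. xpow (single 0 r) * f \<in> exchange_ideal M N a b u v}" (is "saturation n ?W = ?S")
proof (intro equalityI subsetI)
  fix f assume "f \<in> saturation n ?W"
  then obtain k where f: "f \<in> polys n" "\<And>m. m \<in> monomials n k \<Longrightarrow> xpow m * f \<in> ?W"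
    by (auto simp: saturation_def)
  have "xpow (single 0 r) * (xpow (single 0 k) * f) \<in> ?W"
    by (rule ideal_mult[OF ideal_exchange_ideal polys_xpow]) (simp_all add: f(2) monomials_def)
  then have "xpow (single 0 k) * (xpow (single 0 r) * f) \<in> ?W"
    by (simp add: mult.left_commute)
  then have "xpow (single 0 r) * f \<in> ?W"
    by (rule exchange_ideal_cancel) (auto simp: keys_xpow_mult mdeg_add)
  with f(1) show "f \<in> ?S"
    by simp
next
  fix f assume f: "f \<in> ?S"
  have "xpow m * f \<in> ?W" if m: "m \<in> monomials n r" for m
  proof (rule exchange_ideal_cancel)
    have "xpow m * (xpow (single 0 r) * f) \<in> ?W"
      by (rule ideal_mult[OF ideal_exchange_ideal polys_xpow])
        (use f m in \<open>simp_all add: monomials_def\<close>)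
    then show "xpow (single 0 r) * (xpow m * f) \<in> ?W"
      by (simp add: mult.left_commute)
    show "r \<le> mdeg m'" if "m' \<in> keys (xpow m * f)" for m'
      using that m by (auto simp: keys_xpow_mult mdeg_add monomials_def)
  qed
  then show "f \<in> saturation n ?W"
    using f by (auto simp: saturation_def)
qed

lemma closed_subscheme_saturation:
  "closed_subscheme n (saturation n (exchange_ideal M N a b u v))" (is "closed_subscheme n ?X")
proof -
  let ?W = "exchange_ideal M N a b u v" and ?x = "xpow (single 0 r) :: 'a mpoly"
  note X = saturation_exchange_ideal[of u v]
  have "ideal ?X (poly_ring n)"
  proof (rule ideal_poly_ringI)
    show "?X \<subseteq> polys n"
      by (auto simp: X)
    show "0 \<in> ?X"
      using ideal_zero[OF ideal_exchange_ideal] by (simp add: X polys_zero)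
    show "f + g \<in> ?X" if "f \<in> ?X" "g \<in> ?X" for f g
      using that by (simp add: X polys_add distrib_left ideal_add[OF ideal_exchange_ideal])
    show "single m c * f \<in> ?X" if "f \<in> ?X" "keys m \<subseteq> {..n}" for f m c
      using that
      by (simp add: X polys_mult polys_single ideal_mult[OF ideal_exchange_ideal]
          mult.left_commute[of ?x])
  qed
  moreover have "hom_component d f \<in> ?X" if "f \<in> ?X" for d f
  proof -
    have "?x * hom_component d f = hom_component (mdeg (single 0 r) + d) (?x * f)"
      by (simp only: hom_component_xpow_mult)
    moreover have "hom_component d f \<in> polys n"
      using that by (auto simp: X polys_def in_keys_iff lookup_hom_component split: if_splits)
    ultimately show ?thesis
      using that homogeneous_exchange_ideal[of u v] by (simp add: X homogeneous_ideal_def)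
  qed
  moreover have "saturation n ?X = ?X"
  proof (intro equalityI subsetI)
    fix f assume "f \<in> saturation n ?X"
    then obtain k where f: "f \<in> polys n" "\<And>m. m \<in> monomials n k \<Longrightarrow> xpow m * f \<in> ?X"
      by (auto simp: saturation_def)
    have "xpow (single 0 k) * f \<in> ?X"
      by (rule f(2)) (simp add: monomials_def)
    then have "xpow (single 0 k) * (?x * f) \<in> ?W"
      by (simp add: X mult.left_commute)
    then have "?x * f \<in> ?W"
      by (rule exchange_ideal_cancel) (auto simp: keys_xpow_mult mdeg_add)
    then show "f \<in> ?X"
      using f(1) by (simp add: X)
  next
    fix f assume "f \<in> ?X"
    then show "f \<in> saturation n ?X"
      unfolding saturation_def[of n ?X]
      by (auto simp: X monomials_def xpow_def intro!: exI[of _ 0])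
  qed
  ultimately show ?thesis
    by (simp add: closed_subscheme_def homogeneous_ideal_def)
qed

lemma graded_part_saturation:
  assumes "r \<le> t"
  shows "graded_part n (saturation n (exchange_ideal M N a b u v)) t =
    graded_part n (exchange_ideal M N a b u v) t" (is "?L = ?R")
proof (intro equalityI subsetI)
  fix f assume "f \<in> ?L"
  then have f: "f \<in> forms n t" "xpow (single 0 r) * f \<in> exchange_ideal M N a b u v"
    by (auto simp: graded_part_def saturation_exchange_ideal)
  have "f \<in> exchange_ideal M N a b u v"
    using f(2) by (rule exchange_ideal_cancel) (use f(1) assms in \<open>auto simp: forms_def monomials_def\<close>)
  then show "f \<in> ?R"
    using f(1) by (simp add: graded_part_def)
next
  fix f assume "f \<in> ?R"
  then show "f \<in> ?L"
    using forms_subset_polys[of n t] ideal_mult[OF ideal_exchange_ideal polys_xpow, of "single 0 r" f u v]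
    by (auto simp: graded_part_def saturation_exchange_ideal)
qed

lemma exchange_ideal_1_0: "exchange_ideal M N a b 1 0 = {f :: 'k::field mpoly. keys f \<subseteq> M}"
proof (intro equalityI subsetI)
  fix f :: "'k mpoly" assume f: "f \<in> exchange_ideal M N a b 1 0"
  have "m' \<in> M" if m': "m' \<in> keys f" for m'
  proof (rule ccontr)
    assume "m' \<notin> M"
    with f m' have "m' \<in> N - M"
      by (auto simp: exchange_ideal_def)
    then obtain m where "m \<in> M - N" "m + b = m' + a"
      using partner_M by blast
    with f m' show False
      by (auto simp: exchange_ideal_def in_keys_iff)
  qed
  then show "f \<in> {f. keys f \<subseteq> M}"
    by blast
next
  fix f :: "'k mpoly" assume f: "f \<in> {f. keys f \<subseteq> M}"
  have "lookup f m' = 0" if "m \<in> M - N" "m + b = m' + a" for m m'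
    using f partner_in[OF that(1)] partner_unique[OF that(2)] by (auto simp: in_keys_iff)
  with f show "f \<in> exchange_ideal M N a b 1 0"
    by (auto simp: exchange_ideal_def)
qed

lemma exchange_ideal_0_1: "exchange_ideal M N a b 0 1 = {f :: 'k::field mpoly. keys f \<subseteq> N}"
proof (intro equalityI subsetI)
  fix f :: "'k mpoly" assume f: "f \<in> exchange_ideal M N a b 0 1"
  have "m \<in> N" if m: "m \<in> keys f" for m
  proof (rule ccontr)
    assume "m \<notin> N"
    with f m have "m \<in> M - N"
      by (auto simp: exchange_ideal_def)
    with f m partner_eq[of m] show False
      by (auto simp: exchange_ideal_def in_keys_iff)
  qed
  then show "f \<in> {f. keys f \<subseteq> N}"
    by blast
next
  fix f :: "'k mpoly" assume f: "f \<in> {f. keys f \<subseteq> N}"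
  then show "f \<in> exchange_ideal M N a b 0 1"
    by (auto simp: exchange_ideal_def in_keys_iff)
qed

lemma exchange_ideal_scale:
  assumes "c \<noteq> 0"
  shows "exchange_ideal M N a b (c * u) (c * v) = exchange_ideal M N a b u v"
  using assms by (simp add: exchange_ideal_def mult.assoc)

lemma exchange_gen_in:
  assumes "m \<in> M"
  shows "exchange_gen M N a b u v m \<in> graded_part n (exchange_ideal M N a b u v) (mdeg m)"
proof (cases "m \<in> M - N")
  case True
  let ?m' = "m + b - a"
  have m': "?m' \<in> N - M"
    by (rule partner_in[OF True])
  have "keys (exchange_gen M N a b u v m) \<subseteq> {m, ?m'}"
    using True keys_add[of "single m u" "single ?m' v"] by (auto simp: exchange_gen_def split: if_splits)
  moreover have "mdeg ?m' = mdeg m"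
    using arg_cong[OF partner_eq[OF True], of mdeg] mdeg_eq by (simp add: mdeg_add)
  moreover have "keys m \<subseteq> {..n}" "keys ?m' \<subseteq> {..n}"
    using keys_subset True m' by blast+
  moreover have "u * lookup (exchange_gen M N a b u v m) m1' = v * lookup (exchange_gen M N a b u v m) m1"
    if m1: "m1 \<in> M - N" "m1 + b = m1' + a" for m1 m1'
  proof -
    have m1': "m1' = m1 + b - a" "m1' \<in> N - M"
      using partner_unique[OF m1(2)] partner_in[OF m1(1)] by auto
    have "?m' = m1' \<longleftrightarrow> m = m1"
      using partner_inj[OF True m1(1)] m1'(1) by auto
    moreover have "m \<noteq> m1'" "?m' \<noteq> m1"
      using True m1 m1' m' by auto
    ultimately show ?thesis
      using True by (simp add: exchange_gen_def lookup_add lookup_single when_def)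
  qed
  ultimately show ?thesis
    using True m' by (fastforce simp: graded_part_def exchange_ideal_def forms_def monomials_def)
next
  case False
  then have "lookup (xpow m :: 'a mpoly) m1 = 0" "lookup (xpow m :: 'a mpoly) m1' = 0"
    if "m1 \<in> M - N" "m1 + b = m1' + a" for m1 m1'
    using assms that partner_in[OF that(1)] partner_unique[OF that(2)]
    by (auto simp: xpow_def lookup_single when_def)
  moreover have "keys (xpow m :: 'a mpoly) = {m}"
    by (simp add: xpow_def)
  ultimately have "xpow m \<in> exchange_ideal M N a b u v"
    and "(xpow m :: 'a mpoly) \<in> forms n (mdeg m)"
    using assms keys_subset[of m] by (auto simp: exchange_ideal_def forms_def monomials_def)
  then show ?thesis
    using False by (auto simp: exchange_gen_def graded_part_def)
qed

text \<open>
  At a pivot, the element of the basis with this index has a nonzero coefficient and all other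
  elements have coefficient zero.  In $u m + v m x^b/x^a$ the first term can serve unless $u = 0$.
\<close>

definition pivot :: "'k::field \<Rightarrow> mon \<Rightarrow> mon" where
  "pivot u m = (if m \<in> M - N \<and> u = 0 then m + b - a else m)"

definition pivot_coeff :: "'k::field \<Rightarrow> 'k \<Rightarrow> mon \<Rightarrow> 'k" where
  "pivot_coeff u v m = (if m \<in> M - N then if u = 0 then v else u else 1)"

lemma lookup_exchange_gen_pivot:
  assumes "m \<in> M" "m' \<in> M"
  shows "lookup (exchange_gen M N a b u v m) (pivot u m') = (if m = m' then pivot_coeff u v m else 0)"
proof -
  have "m' \<in> M - N \<Longrightarrow> m \<noteq> m' + b - a" "m \<in> M - N \<Longrightarrow> m + b - a \<noteq> m'"
    using assms partner_in by blast+
  then show ?thesis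
    using assms partner_inj[of m m']
    by (auto simp: exchange_gen_def pivot_def pivot_coeff_def xpow_def lookup_add lookup_single when_def)
qed

text \<open>
  The condition linking the coefficients of $m$ and $m x^b/x^a$ determines one of them from the
  other, that at the pivot.
\<close>

lemma exchange_ideal_eq_0_if_pivots:
  assumes f: "f \<in> exchange_ideal M N a b u v" and "(u, v) \<noteq> (0, 0)"
    and zero: "\<And>m. m \<in> M \<Longrightarrow> m \<in> keys f \<or> m + b - a \<in> keys f \<Longrightarrow> lookup f (pivot u m) = 0"
  shows "f = 0"
proof -
  have "lookup f m = 0 \<and> lookup f (m + b - a) = 0" if m: "m \<in> M - N" for m
  proof (rule ccontr)
    assume *: "\<not> ?thesis"
    then have "lookup f (pivot u m) = 0"
      using zero m by (auto simp: in_keys_iff)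
    moreover have "u * lookup f (m + b - a) = v * lookup f m"
      using f m partner_eq[OF m] by (simp add: exchange_ideal_def)
    ultimately show False
      using m * \<open>(u, v) \<noteq> (0, 0)\<close> by (auto simp: pivot_def split: if_splits)
  qed note 1 = this
  have "lookup f m = 0" for m
  proof (rule ccontr)
    assume m: "lookup f m \<noteq> 0"
    then have "m \<in> M \<union> N"
      using f by (auto simp: exchange_ideal_def in_keys_iff)
    then consider "m \<in> M - N" | "m \<in> N - M" | "m \<in> M \<inter> N"
      by blast
    then show False
    proof cases
      case 2
      then obtain m0 where "m0 \<in> M - N" "m0 + b = m + a"
        using partner_M by blast
      then show False
        using 1[of m0] partner_unique[of m0 m] m by simp
    qed (use 1[of m] zero[of m] m in \<open>auto simp: pivot_def in_keys_iff\<close>)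
  qed
  then show ?thesis
    by (intro poly_mapping_eqI) simp
qed

lemma finite_graded: "finite {m \<in> M. mdeg m = t}"
  by (rule finite_subset[OF _ finite_monomials[of n t]]) (use keys_subset in \<open>auto simp: monomials_def\<close>)

lemma
  fixes u v :: "'k::field"
  assumes "(u, v) \<noteq> (0, 0)"
  shows inj_on_exchange_gen: "inj_on (exchange_gen M N a b u v) {m \<in> M. mdeg m = t}"
    and independent_exchange_gen:
      "\<not> mpoly.dependent (exchange_gen M N a b u v ` {m \<in> M. mdeg m = t})"
    and span_exchange_gen:
      "mpoly.span (exchange_gen M N a b u v ` {m \<in> M. mdeg m = t}) =
        graded_part n (exchange_ideal M N a b u v) t"
proof -
  let ?g = "exchange_gen M N a b u v" and ?X = "{m \<in> M. mdeg m = t}"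
    and ?V = "graded_part n (exchange_ideal M N a b u v) t"
  have nonzero: "pivot_coeff u v m \<noteq> 0" for m
    using assms by (auto simp: pivot_coeff_def)
  have piv: "lookup (?g m) (pivot u m') = (if m = m' then pivot_coeff u v m else 0)"
    if "m \<in> ?X" "m' \<in> ?X" for m m'
    using lookup_exchange_gen_pivot[of m m' u v] that by simp
  show "inj_on ?g ?X" "\<not> mpoly.dependent (?g ` ?X)"
    using inj_on_if_pivots[OF finite_graded piv nonzero] independent_if_pivots[OF finite_graded piv nonzero]
    by blast+
  have sub: "mpoly.subspace ?V"
    by (rule subspace_graded_part[OF ideal_exchange_ideal])
  show "mpoly.span (?g ` ?X) = ?V"
  proof (intro equalityI subsetI)
    fix f assume "f \<in> mpoly.span (?g ` ?X)"
    moreover have "mpoly.span (?g ` ?X) \<subseteq> ?V"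
      by (rule mpoly.span_minimal[OF _ sub]) (use exchange_gen_in in blast)
    ultimately show "f \<in> ?V" by blast
  next
    fix f assume f: "f \<in> ?V"
    define s where "s = (\<Sum>m\<in>?X. smult_mpoly (lookup f (pivot u m) / pivot_coeff u v m) (?g m))"
    have s: "s \<in> mpoly.span (?g ` ?X)"
      unfolding s_def by (intro mpoly.span_sum mpoly.span_scale mpoly.span_base) auto
    have "s \<in> ?V"
      unfolding s_def by (intro mpoly.subspace_sum[OF sub] mpoly.subspace_scale[OF sub])
        (use exchange_gen_in in blast)
    then have V: "f - s \<in> ?V"
      by (rule mpoly.subspace_diff[OF sub f])
    \<comment> \<open>\<open>s\<close> is the combination of the basis with the same coefficients at the pivots as \<open>f\<close>.\<close>
    have "f - s = 0"
    proof (rule exchange_ideal_eq_0_if_pivots[OF _ assms])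
      show "f - s \<in> exchange_ideal M N a b u v"
        using V by (simp add: graded_part_def)
      fix m assume m: "m \<in> M" "m \<in> keys (f - s) \<or> m + b - a \<in> keys (f - s)"
      show "lookup (f - s) (pivot u m) = 0"
      proof (cases "mdeg m = t")
        case True
        have "lookup s (pivot u m) =
          (\<Sum>m'\<in>?X. lookup f (pivot u m') / pivot_coeff u v m' * lookup (?g m') (pivot u m))"
          by (simp add: s_def lookup_sum lookup_smult)
        also have "\<dots> = (\<Sum>m'\<in>?X. if m' = m then lookup f (pivot u m) else 0)"
          using m True nonzero by (intro sum.cong) (auto simp: piv)
        also have "\<dots> = lookup f (pivot u m)"
          using m True finite_graded[of t] by simp
        finally show ?thesis
          by (simp add: lookup_minus)
      next
        case False
        have "mdeg (pivot u m) = mdeg m"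
          using m arg_cong[OF partner_eq[of m], of mdeg] mdeg_eq
          by (auto simp: pivot_def mdeg_add)
        then show ?thesis
          using False V by (auto simp: graded_part_def forms_def monomials_def in_keys_iff)
      qed
    qed
    then show "f \<in> mpoly.span (?g ` ?X)"
      using s by simp
  qed
qed

text \<open>The number of elements of the basis in each degree depends on $M$ only.\<close>

lemma hilbert_function_exchange_ideal:
  fixes u v :: "'k::field"
  assumes "(u, v) \<noteq> (0, 0)"
  shows "hilbert_function n (exchange_ideal M N a b u v) t =
    hilbert_function n {f :: 'k mpoly. keys f \<subseteq> M} t"
proof -
  have "mpoly.dim (graded_part n (exchange_ideal M N a b u v) t) = card {m \<in> M. mdeg m = t}"
    if "(u, v) \<noteq> (0, 0)" for u v :: 'k
    using mpoly.dim_span_eq_card_independent[OF independent_exchange_gen[OF that, of t]]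
    by (simp add: span_exchange_gen[OF that] card_image inj_on_exchange_gen[OF that])
  from this[OF assms] this[of 1 0] show ?thesis
    by (simp add: hilbert_function_def exchange_ideal_1_0)
qed

lemma saturation_in_hilb:
  fixes u v :: "'k::field"
  assumes "(u, v) \<noteq> (0, 0)" and p: "has_hilbert_poly n {f :: 'k mpoly. keys f \<subseteq> M} p"
  shows "saturation n (exchange_ideal M N a b u v) \<in> hilb n p"
proof -
  have "\<forall>\<^sub>F t in sequentially.
      of_nat (hilbert_function n (saturation n (exchange_ideal M N a b u v)) t) = poly p (of_nat t)"
    using p[unfolded has_hilbert_poly_def] eventually_ge_at_top[of r]
  proof eventually_elim
    case (elim t)
    then show ?case
      using hilbert_function_exchange_ideal[OF assms(1), of t]
      by (simp add: hilbert_function_def graded_part_saturation)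
  qed
  then show ?thesis
    by (simp add: hilb_def has_hilbert_poly_def closed_subscheme_saturation)
qed

end

section \<open>The pencil as a curve in Pluecker coordinates\<close>

definition is_binary_form :: "nat \<Rightarrow> ('k::field \<times> 'k \<Rightarrow> 'k) \<Rightarrow> bool" where
  "is_binary_form d \<phi> \<longleftrightarrow> (\<exists>g. \<phi> = binary_form d g)"

lemma is_binary_form_const: "is_binary_form 0 (\<lambda>_. c)"
  unfolding is_binary_form_def by (rule exI[of _ "\<lambda>_. c"]) (simp add: binary_form_def fun_eq_iff)

lemma is_binary_form_zero: "is_binary_form d (\<lambda>_. 0)"
  unfolding is_binary_form_def by (rule exI[of _ "\<lambda>_. 0"]) (simp add: binary_form_def fun_eq_iff)

lemma is_binary_form_add:
  assumes "is_binary_form d \<phi>" "is_binary_form d \<psi>"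
  shows "is_binary_form d (\<lambda>y. \<phi> y + \<psi> y)"
proof -
  from assms obtain g h where "\<phi> = binary_form d g" "\<psi> = binary_form d h"
    by (auto simp: is_binary_form_def)
  then have "(\<lambda>y. \<phi> y + \<psi> y) = binary_form d (\<lambda>k. g k + h k)"
    by (auto simp: binary_form_def fun_eq_iff distrib_right sum.distrib)
  then show ?thesis
    by (auto simp: is_binary_form_def)
qed

lemma is_binary_form_scale:
  assumes "is_binary_form d \<phi>"
  shows "is_binary_form d (\<lambda>y. c * \<phi> y)"
proof -
  from assms obtain g where "\<phi> = binary_form d g"
    by (auto simp: is_binary_form_def)
  then have "(\<lambda>y. c * \<phi> y) = binary_form d (\<lambda>k. c * g k)"
    by (auto simp: binary_form_def fun_eq_iff sum_distrib_left mult.assoc)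
  then show ?thesis
    by (auto simp: is_binary_form_def)
qed

lemma is_binary_form_sum:
  assumes "\<And>x. x \<in> X \<Longrightarrow> is_binary_form d (\<phi> x)"
  shows "is_binary_form d (\<lambda>y. \<Sum>x\<in>X. \<phi> x y)"
  using assms
  by (induction X rule: infinite_finite_induct)
    (simp_all add: is_binary_form_zero is_binary_form_add)

lemma is_binary_form_mult_fst:
  assumes "is_binary_form d \<phi>"
  shows "is_binary_form (Suc d) (\<lambda>y. fst y * \<phi> y)"
proof -
  from assms obtain g where "\<phi> = binary_form d g"
    by (auto simp: is_binary_form_def)
  then have "(\<lambda>y. fst y * \<phi> y) = binary_form (Suc d) (\<lambda>k. case k of 0 \<Rightarrow> 0 | Suc k' \<Rightarrow> g k')"
    by (auto simp: binary_form_def fun_eq_iff sum_distrib_left sum.atMost_Suc_shift mult_ac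
        simp del: sum.atMost_Suc)
  then show ?thesis
    by (auto simp: is_binary_form_def)
qed

lemma is_binary_form_mult_snd:
  assumes "is_binary_form d \<phi>"
  shows "is_binary_form (Suc d) (\<lambda>y. snd y * \<phi> y)"
proof -
  from assms obtain g where "\<phi> = binary_form d g"
    by (auto simp: is_binary_form_def)
  then have "(\<lambda>y. snd y * \<phi> y) = binary_form (Suc d) (\<lambda>k. if k \<le> d then g k else 0)"
    by (auto simp: binary_form_def fun_eq_iff sum_distrib_left Suc_diff_le mult_ac intro!: sum.cong)
  then show ?thesis
    by (auto simp: is_binary_form_def)
qed

lemma is_binary_form_mult_linear:
  assumes "is_binary_form d \<phi>"
  shows "is_binary_form (Suc d) (\<lambda>y. (\<alpha> * fst y + \<beta> * snd y) * \<phi> y)"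
proof -
  have "is_binary_form (Suc d) (\<lambda>y. \<alpha> * (fst y * \<phi> y) + \<beta> * (snd y * \<phi> y))"
    by (intro is_binary_form_add is_binary_form_scale is_binary_form_mult_fst
        is_binary_form_mult_snd assms)
  then show ?thesis
    by (simp add: distrib_right mult.assoc)
qed

text \<open>
  Each product in the Leibniz formula contains exactly one entry of each row, and thus as many
  linear factors as there are linear rows.
\<close>

lemma is_binary_form_det:
  fixes L :: "nat \<Rightarrow> nat \<Rightarrow> 'k::field \<times> 'k \<Rightarrow> 'k"
  assumes linear: "\<And>i j. i \<in> X \<Longrightarrow> \<exists>\<alpha> \<beta>. L i j = (\<lambda>y. \<alpha> * fst y + \<beta> * snd y)"
    and const: "\<And>i j. i \<notin> X \<Longrightarrow> \<exists>c. L i j = (\<lambda>_. c)"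
  shows "is_binary_form (card ({..<l} \<inter> X)) (\<lambda>y. det (mat l l (\<lambda>(i, j). L i j y)))"
proof -
  have prod: "is_binary_form (card ({..<k} \<inter> X)) (\<lambda>y. \<Prod>i<k. L i (p i) y)" for p k
  proof (induction k)
    case 0
    then show ?case
      by (simp add: is_binary_form_const)
  next
    case (Suc k)
    show ?case
    proof (cases "k \<in> X")
      case True
      then obtain \<alpha> \<beta> where "L k (p k) = (\<lambda>y. \<alpha> * fst y + \<beta> * snd y)"
        using linear by blast
      then show ?thesis
        using True is_binary_form_mult_linear[OF Suc, of \<alpha> \<beta>]
        by (simp add: lessThan_Suc Int_insert_left mult.commute)
    next
      case False
      then obtain c where "L k (p k) = (\<lambda>_. c)"
        using const by blast
      then show ?thesis
        using False is_binary_form_scale[OF Suc, of c]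
        by (simp add: lessThan_Suc Int_insert_left mult.commute)
    qed
  qed
  have det: "det (mat l l (\<lambda>(i, j). L i j y)) =
      (\<Sum>p\<in>{p. p permutes {0..<l}}. signof p * (\<Prod>i<l. L i (p i) y))" for y
  proof -
    have "(\<Prod>i = 0..<l. mat l l (\<lambda>(i, j). L i j y) $$ (i, p i)) = (\<Prod>i<l. L i (p i) y)"
      if "p permutes {0..<l}" for p
    proof (rule prod.cong)
      fix i assume "i \<in> {..<l}"
      moreover from this have "p i < l"
        using permutes_in_image[OF that, of i] by simp
      ultimately show "mat l l (\<lambda>(i, j). L i j y) $$ (i, p i) = L i (p i) y"
        by simp
    qed auto
    then show ?thesis
      by (simp add: det_def)
  qed
  show ?thesis
    unfolding det by (intro is_binary_form_sum is_binary_form_scale prod)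
qed

context monomial_exchange
begin

lemma plucker_coords_exchange_ideal:
  "\<exists>d G. \<forall>y. y \<noteq> (0, 0) \<longrightarrow> (\<lambda>ms. binary_form d (G ms) y) \<in>
    plucker_coords n r (graded_part n (exchange_ideal M N a b (fst y) (snd y :: 'k::field)) r)"
proof -
  obtain xs where xs: "set xs = {m \<in> M. mdeg m = r}" "distinct xs"
    using finite_distinct_list[OF finite_graded] by blast
  define l where "l = length xs"
  define L :: "mon list \<Rightarrow> nat \<Rightarrow> nat \<Rightarrow> 'k \<times> 'k \<Rightarrow> 'k" where
    "L ms i j y = lookup (exchange_gen M N a b (fst y) (snd y) (xs ! i)) (ms ! j)" for ms i j y
  define X where "X = {i. xs ! i \<in> M - N}"
  define ok where "ok ms \<longleftrightarrow> set ms \<subseteq> monomials n r \<and> length ms = l" for ms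
  have "is_binary_form (card ({..<l} \<inter> X)) (\<lambda>y. det (mat l l (\<lambda>(i, j). L ms i j y)))" for ms
  proof (rule is_binary_form_det)
    fix i j assume "i \<in> X"
    then have "L ms i j = (\<lambda>y. (if xs ! i = ms ! j then 1 else 0) * fst y +
        (if xs ! i + b - a = ms ! j then 1 else 0) * snd y)"
      by (auto simp: L_def X_def exchange_gen_def lookup_add lookup_single when_def fun_eq_iff)
    then show "\<exists>\<alpha> \<beta>. L ms i j = (\<lambda>y. \<alpha> * fst y + \<beta> * snd y)"
      by blast
  next
    fix i j assume "i \<notin> X"
    then have "L ms i j = (\<lambda>_. lookup (xpow (xs ! i)) (ms ! j))"
      by (auto simp: L_def X_def exchange_gen_def fun_eq_iff)
    then show "\<exists>c. L ms i j = (\<lambda>_. c)"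
      by blast
  qed
  then have "\<exists>g. \<forall>y. binary_form (card ({..<l} \<inter> X)) g y =
      (if ok ms then det (mat l l (\<lambda>(i, j). L ms i j y)) else 0)" for ms
    using is_binary_form_zero[of "card ({..<l} \<inter> X)"]
    by (cases "ok ms") (auto simp: is_binary_form_def fun_eq_iff, metis+)
  then obtain G where G: "\<And>ms y. binary_form (card ({..<l} \<inter> X)) (G ms) y =
      (if ok ms then det (mat l l (\<lambda>(i, j). L ms i j y)) else 0)"
    by metis
  have "(\<lambda>ms. binary_form (card ({..<l} \<inter> X)) (G ms) y) \<in>
      plucker_coords n r (graded_part n (exchange_ideal M N a b (fst y) (snd y)) r)"
    if "y \<noteq> (0, 0)" for y
  proof -
    let ?g = "exchange_gen M N a b (fst y) (snd y)"
    let ?bs = "map ?g xs"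
    have y: "(fst y, snd y) \<noteq> (0, 0)"
      using that by simp
    have "distinct ?bs" "\<not> mpoly.dependent (set ?bs)"
      "mpoly.span (set ?bs) = graded_part n (exchange_ideal M N a b (fst y) (snd y)) r"
      using xs inj_on_exchange_gen[OF y, of r] independent_exchange_gen[OF y, of r]
        span_exchange_gen[OF y, of r]
      by (simp_all add: distinct_map)
    moreover have mat: "mat l l (\<lambda>(i, j). L ms i j y) =
        mat (length ?bs) (length ?bs) (\<lambda>(i, j). lookup (?bs ! i) (ms ! j))" for ms
      by (intro cong_mat) (auto simp: l_def L_def)
    have "(\<lambda>ms. binary_form (card ({..<l} \<inter> X)) (G ms) y) =
        (\<lambda>ms. if set ms \<subseteq> monomials n r \<and> length ms = length ?bs
          then 1 * det (mat (length ?bs) (length ?bs) (\<lambda>(i, j). lookup (?bs ! i) (ms ! j))) else 0)"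
      unfolding G ok_def mat by (simp only: l_def length_map mult_1_left)
    ultimately show ?thesis
      unfolding plucker_coords_def mem_Collect_eq
      by (intro exI[of _ 1] exI[of _ ?bs] conjI) simp_all
  qed
  then show ?thesis
    by blast
qed

text \<open>
  A point of $P^1$ is a class of pairs; by \<open>exchange_ideal_scale\<close> any pair in it gives the same
  ideal.
\<close>

definition exchange_curve :: "('k \<times> 'k) set \<Rightarrow> 'k::field mpoly set" where
  "exchange_curve Q =
    saturation n (exchange_ideal M N a b (fst (SOME y. y \<in> Q)) (snd (SOME y. y \<in> Q)))"

lemma
  assumes "Q \<in> proj_line" "y \<in> Q"
  shows proj_line_nonzero: "y \<noteq> (0, 0)"
    and exchange_curve_eq: "exchange_curve Q = saturation n (exchange_ideal M N a b (fst y) (snd y))"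
proof -
  from assms(1) obtain u v where uv: "(u, v) \<noteq> (0, 0)" and Q: "Q = {(c * u, c * v) | c. c \<noteq> 0}"
    by (auto simp: proj_line_def)
  have *: "z \<noteq> (0, 0) \<and>
      exchange_ideal M N a b (fst z) (snd z) = exchange_ideal M N a b u v" if "z \<in> Q" for z
    using that uv by (auto simp: Q exchange_ideal_scale)
  show "y \<noteq> (0, 0)"
    using *[OF assms(2)] by simp
  have "(SOME z. z \<in> Q) \<in> Q"
    using assms(2) by (rule someI)
  then show "exchange_curve Q = saturation n (exchange_ideal M N a b (fst y) (snd y))"
    using *[OF assms(2)] * by (simp add: exchange_curve_def)
qed

lemma proj_line_nonempty: "Q \<in> proj_line \<Longrightarrow> \<exists>y. y \<in> Q"
  by (auto simp: proj_line_def intro: exI[of _ 1])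

text \<open>
  The curve is not constant because its values at $(1 : 0)$ and $(0 : 1)$ differ in the degree of
  any monomial in \<open>M - N\<close>; this degree is at least $r$, so saturation does not blur the
  difference.
\<close>

lemma rational_curve_exchange:
  assumes p: "has_hilbert_poly n {f :: 'k::field mpoly. keys f \<subseteq> M} p" and "\<not> M \<subseteq> N"
  shows "\<exists>C. rational_curve n p r C \<and>
    saturation n {f :: 'k mpoly. keys f \<subseteq> M} \<in> C ` proj_line \<and>
    saturation n {f :: 'k mpoly. keys f \<subseteq> N} \<in> C ` proj_line"
proof -
  let ?C = "exchange_curve :: ('k \<times> 'k) set \<Rightarrow> 'k mpoly set"
  have morphism: "morphism_to_hilb n p r ?C"
    unfolding morphism_to_hilb_def
  proof (intro conjI ballI)
    show "?C ` proj_line \<subseteq> hilb n p"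
    proof clarify
      fix Q :: "('k \<times> 'k) set" assume Q: "Q \<in> proj_line"
      then obtain y where y: "y \<in> Q"
        using proj_line_nonempty by blast
      show "?C Q \<in> hilb n p"
        using saturation_in_hilb[of "fst y" "snd y", OF _ p] proj_line_nonzero[OF Q y]
        by (simp add: exchange_curve_eq[OF Q y])
    qed
    obtain d G where G: "\<And>y. y \<noteq> (0, 0) \<Longrightarrow> (\<lambda>ms. binary_form d (G ms) y) \<in>
        plucker_coords n r (graded_part n (exchange_ideal M N a b (fst y) (snd y :: 'k)) r)"
      using plucker_coords_exchange_ideal by blast
    fix P :: "('k \<times> 'k) set" assume "P \<in> proj_line"
    moreover have "(\<lambda>ms. binary_form d (G ms) y) \<in> plucker_coords n r (graded_part n (?C Q) r)"
      if "Q \<in> proj_line" "y \<in> Q" for Q y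
      using G[of y] proj_line_nonzero[OF that]
      by (simp add: exchange_curve_eq[OF that] graded_part_saturation)
    ultimately show "\<exists>U d G. P \<in> U \<and> U \<subseteq> proj_line \<and> finite (proj_line - U) \<and>
        (\<forall>Q\<in>U. \<forall>y\<in>Q. (\<lambda>ms. binary_form d (G ms) y) \<in> plucker_coords n r (graded_part n (?C Q) r))"
      by (intro exI[of _ proj_line] exI[of _ d] exI[of _ G]) auto
  qed
  define cls where "cls u v = {(c * u, c * v) | c. c \<noteq> (0 :: 'k)}" for u v :: 'k
  have cls: "cls u v \<in> proj_line" "(u, v) \<in> cls u v" if "(u, v) \<noteq> (0, 0)" for u v
    using that by (auto simp: cls_def proj_line_def intro: exI[of _ 1])
  have "?C (cls 1 0) = saturation n {f :: 'k mpoly. keys f \<subseteq> M}"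
    and "?C (cls 0 1) = saturation n {f :: 'k mpoly. keys f \<subseteq> N}"
    using exchange_curve_eq[OF cls[of 1 0]] exchange_curve_eq[OF cls[of 0 1]]
    by (simp_all add: exchange_ideal_1_0 exchange_ideal_0_1)
  note ends = this
  have "?C (cls 1 0) \<noteq> ?C (cls 0 1)"
  proof
    assume eq: "?C (cls 1 0) = ?C (cls 0 1)"
    obtain m where m: "m \<in> M" "m \<notin> N"
      using \<open>\<not> M \<subseteq> N\<close> by blast
    have "graded_part n {f :: 'k mpoly. keys f \<subseteq> M} (mdeg m) =
        graded_part n {f :: 'k mpoly. keys f \<subseteq> N} (mdeg m)"
      using graded_part_saturation[of "mdeg m" "1 :: 'k" 0] graded_part_saturation[of "mdeg m" "0 :: 'k" 1]
        mdeg_ge[of m] m(1) eq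
      by (simp add: ends exchange_ideal_1_0 exchange_ideal_0_1)
    moreover have "xpow m \<in> graded_part n {f :: 'k mpoly. keys f \<subseteq> M} (mdeg m)"
      using m keys_subset[of m] by (simp add: graded_part_def forms_def monomials_def xpow_def)
    ultimately show False
      using m by (simp add: graded_part_def xpow_def)
  qed
  then have "rational_curve n p r ?C"
    using morphism cls[of 1 0] cls[of 0 1] unfolding rational_curve_def by auto
  moreover have "?C (cls 1 0) \<in> ?C ` proj_line" "?C (cls 0 1) \<in> ?C ` proj_line"
    using cls[of 1 0] cls[of 0 1] by auto
  ultimately show ?thesis
    unfolding ends by blast
qed

end

section \<open>Borel sets and the monomials they generate\<close>

definition borel_set :: "nat \<Rightarrow> nat \<Rightarrow> mon set \<Rightarrow> bool" where
  "borel_set n r B \<longleftrightarrow> B \<subseteq> monomials n r \<and>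
    (\<forall>m\<in>B. \<forall>i j. i \<in> keys m \<and> i < j \<and> j \<le> n \<longrightarrow> m - single i 1 + single j 1 \<in> B)"

definition multiples :: "nat \<Rightarrow> mon set \<Rightarrow> mon set" where
  "multiples n B = {h + w | h w. h \<in> B \<and> keys w \<subseteq> {..n}}"

text \<open>
  The condition $\max w \le \min h$ on indices of variables, in a form that makes sense also if
  $w$ or $h$ is $1$.
\<close>

definition below :: "mon \<Rightarrow> mon \<Rightarrow> bool" where
  "below w h \<longleftrightarrow> (\<forall>i\<in>keys w. \<forall>j\<in>keys h. i \<le> j)"

lemma mon_remove_var: "i \<in> keys m \<Longrightarrow> m = (m - single i 1) + single i 1" for m :: mon
  by (rule poly_mapping_eqI) (auto simp: lookup_add lookup_minus lookup_single when_def in_keys_iff)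

lemma mdeg_move_var: "i \<in> keys m \<Longrightarrow> mdeg (m - single i 1 + single j 1) = mdeg m"
  using arg_cong[OF mon_remove_var, of i m mdeg] by (simp add: mdeg_add)

lemma keys_minus_subset: "keys (m - w) \<subseteq> keys m" for m w :: mon
  by (auto simp: in_keys_iff lookup_minus)

lemma ex_lookup_less:
  assumes "mdeg h = mdeg h'" "h \<noteq> h'"
  shows "\<exists>i. lookup h' i < lookup h i"
proof (rule ccontr)
  assume "\<not> ?thesis"
  then have eq: "h' = h + (h' - h)"
    by (intro poly_mapping_eqI) (simp add: lookup_add lookup_minus not_less)
  have "mdeg h' = mdeg h + mdeg (h' - h)"
    using arg_cong[OF eq, of mdeg] by (simp only: mdeg_add)
  then have "h' - h = 0"
    using assms(1) by (simp flip: mdeg_eq_0_iff)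
  then show False
    using eq assms(2) by (simp only: add_0_right)
qed

text \<open>
  If $h$ and $h'$ have the same degree but differ, then $x_i$ has a larger exponent in $h$ than in
  $h'$ for some $i$, and $x_j$ has a smaller one for some $j$.  Then $x_i$ occurs in $h$ and $w'$,
  and $x_j$ in $h'$ and $w$, which forces both $i \le j$ and $j \le i$.
\<close>

lemma below_decomposition_unique:
  assumes eq: "h + w = h' + w'" and "mdeg h = mdeg h'" and "below w h" "below w' h'"
  shows "h = h'"
proof (rule ccontr)
  assume "h \<noteq> h'"
  then obtain i j where i: "lookup h' i < lookup h i" and j: "lookup h j < lookup h' j"
    using ex_lookup_less assms(2) by metis
  have sum: "lookup h k + lookup w k = lookup h' k + lookup w' k" for k
    using arg_cong[OF eq, of "\<lambda>m. lookup m k"] by (simp add: lookup_add)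
  have "i \<in> keys w'" "j \<in> keys h'" "j \<in> keys w" "i \<in> keys h"
    using i j sum[of i] sum[of j] by (auto simp: in_keys_iff)
  then have "i = j"
    using \<open>below w h\<close> \<open>below w' h'\<close> unfolding below_def by (meson order_antisym)
  with i j show False
    by simp
qed

text \<open>
  As long as a variable $x_i$ of $w$ has a larger index than a variable $x_j$ of $h$, they can be
  interchanged: the new $h$ is in $B$ because $B$ is Borel.  This lowers the sum of the indices of
  the variables in $w$.
\<close>

lemma below_decomposition_exists:
  assumes B: "borel_set n r B" and "h \<in> B" "keys w \<subseteq> {..n}"
  shows "\<exists>h'\<in>B. \<exists>w'. h + w = h' + w' \<and> keys w' \<subseteq> {..n} \<and> below w' h'"
  using assms(2,3)
proof (induction "\<Sum>k\<le>n. k * lookup w k" arbitrary: h w rule: less_induct)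
  case less
  show ?case
  proof (cases "below w h")
    case True
    then show ?thesis
      using less.prems by blast
  next
    case False
    then obtain i j where ij: "i \<in> keys w" "j \<in> keys h" "j < i"
      by (auto simp: below_def not_le)
    then have "i \<le> n"
      using less.prems by blast
    define h0 w0 where "h0 = h - single j 1" and "w0 = w - single i 1"
    have h0: "h = h0 + single j 1" and w0: "w = w0 + single i 1"
      unfolding h0_def w0_def using ij by (blast intro: mon_remove_var)+
    let ?h = "h0 + single i 1" and ?w = "w0 + single j 1"
    have eq: "h + w = ?h + ?w"
      unfolding h0 w0 by (simp only: add_ac)
    have weight: "(\<Sum>k\<le>n. k * lookup (v + single l 1) k) = (\<Sum>k\<le>n. k * lookup v k) + l"
      if "l \<le> n" for v l
    proof -
      have "(\<Sum>k\<le>n. k * lookup (single l 1) k) = (\<Sum>k\<le>n. if k = l then l else 0)"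
        by (intro sum.cong) (auto simp: lookup_single when_def)
      then show ?thesis
        using that by (simp add: lookup_add distrib_left sum.distrib)
    qed
    have "(\<Sum>k\<le>n. k * lookup ?w k) < (\<Sum>k\<le>n. k * lookup w k)"
      using weight[of j w0] weight[of i w0] ij(3) \<open>i \<le> n\<close> by (simp add: w0)
    moreover have "?h \<in> B"
      using B less.prems ij \<open>i \<le> n\<close> unfolding borel_set_def h0_def by blast
    moreover have "keys ?w \<subseteq> {..n}"
      using less.prems(2) ij(3) \<open>i \<le> n\<close> by (auto simp: keys_add_mon w0)
    ultimately show ?thesis
      using less.hyps[of ?w ?h] eq by auto
  qed
qed

lemma in_multiplesE:
  assumes "borel_set n r B" "m \<in> multiples n B"
  obtains h w where "h \<in> B" "keys w \<subseteq> {..n}" "below w h" "m = h + w"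
proof -
  from assms(2) obtain h w where "m = h + w" "h \<in> B" "keys w \<subseteq> {..n}"
    by (auto simp: multiples_def)
  with below_decomposition_exists[OF assms(1), of h w] show thesis
    using that by auto
qed

lemma in_multiplesI: "h \<in> B \<Longrightarrow> keys w \<subseteq> {..n} \<Longrightarrow> h + w \<in> multiples n B"
  by (auto simp: multiples_def)

lemma multiples_iff_head:
  assumes B: "borel_set n r B" and h: "h \<in> monomials n r" "keys w \<subseteq> {..n}" "below w h"
  shows "h + w \<in> multiples n B \<longleftrightarrow> h \<in> B"
proof
  assume "h + w \<in> multiples n B"
  then obtain h' w' where h': "h' \<in> B" "below w' h'" "h + w = h' + w'"
    using in_multiplesE[OF B] by metis
  moreover have "mdeg h = mdeg h'"
    using h(1) h'(1) B by (auto simp: borel_set_def monomials_def)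
  ultimately have "h = h'"
    using below_decomposition_unique h(3) by blast
  with h' show "h \<in> B" by simp
next
  assume "h \<in> B"
  then show "h + w \<in> multiples n B"
    using h(2) by (rule in_multiplesI)
qed

text \<open>
  The decomposition yields the cancellation of $x_0$: if $m$ has degree at least $r$, then
  $x_0 m = h w$ with $w \ne 1$, and as all variables of $w$ are at most those of $h$, the factor
  $x_0$ can be taken from $w$.
\<close>

lemma saturated_multiples:
  assumes B: "borel_set n r B"
  shows "saturated_monomials n r (multiples n B)"
  unfolding saturated_monomials_def
proof (intro conjI ballI allI impI; (elim conjE)?)
  fix m assume "m \<in> multiples n B"
  then obtain h w where m: "m = h + w" "h \<in> B" "keys w \<subseteq> {..n}"
    by (auto simp: multiples_def)
  then have "h \<in> monomials n r"
    using B by (auto simp: borel_set_def)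
  then show "keys m \<subseteq> {..n}" "r \<le> mdeg m"
    using m by (auto simp: keys_add_mon mdeg_add monomials_def)
  show "v + m \<in> multiples n B" if "keys v \<subseteq> {..n}" for v
    using in_multiplesI[of h B "w + v" n] m that by (simp add: keys_add_mon add_ac)
next
  fix m assume deg: "r \<le> mdeg m" and "single 0 1 + m \<in> multiples n B"
  then obtain h w where hw: "h \<in> B" "keys w \<subseteq> {..n}" "below w h" "single 0 1 + m = h + w"
    using in_multiplesE[OF B] by metis
  have "mdeg h = r"
    using B hw(1) by (auto simp: borel_set_def monomials_def)
  then have "0 < mdeg w"
    using arg_cong[OF hw(4), of mdeg] deg by (simp add: mdeg_add)
  then obtain i where i: "i \<in> keys w"
    by (metis mdeg_def sum.empty ex_in_conv less_irrefl)
  have "0 \<in> keys h \<union> keys w"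
    using arg_cong[OF hw(4), of keys] by (auto simp: keys_add_mon)
  then have "0 \<in> keys w"
    using i hw(3) by (auto simp: below_def)
  define w0 where "w0 = w - single 0 1"
  have w0: "w = w0 + single 0 1"
    unfolding w0_def using \<open>0 \<in> keys w\<close> by (rule mon_remove_var)
  have "single 0 1 + m = single 0 1 + (h + w0)"
    unfolding hw(4) w0 by (simp only: add_ac)
  then have "m = h + w0"
    by (simp only: add_left_cancel)
  moreover have "keys w0 \<subseteq> {..n}"
    using hw(2) by (auto simp: w0 keys_add_mon)
  ultimately show "m \<in> multiples n B"
    using hw(1) by (simp add: in_multiplesI)
qed

section \<open>Borel-fixed ideals as sets of polynomials\<close>

lemma ideal_monomials:
  assumes "\<And>m. m \<in> S \<Longrightarrow> keys m \<subseteq> {..n}"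
    and "\<And>m w. m \<in> S \<Longrightarrow> keys w \<subseteq> {..n} \<Longrightarrow> w + m \<in> S"
  shows "ideal {f :: 'k::field mpoly. keys f \<subseteq> S} (poly_ring n)"
proof (rule ideal_poly_ringI)
  show "{f. keys f \<subseteq> S} \<subseteq> polys n"
    using assms(1) unfolding polys_def by blast
  show "f + g \<in> {f. keys f \<subseteq> S}" if "f \<in> {f. keys f \<subseteq> S}" "g \<in> {f. keys f \<subseteq> S}"
    for f g :: "'k mpoly"
    using that keys_add[of f g] by blast
  show "single w c * f \<in> {f. keys f \<subseteq> S}" if "f \<in> {f. keys f \<subseteq> S}" "keys w \<subseteq> {..n}"
    for f :: "'k mpoly" and w c
  proof clarify
    fix m assume "m \<in> keys (single w c * f)"
    then obtain m0 where "m = w + m0" "m0 \<in> keys f"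
      using keys_mult[of "single w c" f] by (auto split: if_splits)
    then show "m \<in> S"
      using that assms(2) by blast
  qed
qed simp

lemma ideal_multiples:
  assumes "\<And>m. m \<in> A \<Longrightarrow> keys m \<subseteq> {..n}"
  shows "ideal {f :: 'k::field mpoly. keys f \<subseteq> multiples n A} (poly_ring n)"
proof (rule ideal_monomials)
  fix m assume "m \<in> multiples n A"
  then obtain h w where m: "m = h + w" "h \<in> A" "keys w \<subseteq> {..n}"
    by (auto simp: multiples_def)
  then show "keys m \<subseteq> {..n}"
    using assms by (auto simp: keys_add_mon)
  show "v + m \<in> multiples n A" if "keys v \<subseteq> {..n}" for v
    using in_multiplesI[of h A "w + v" n] m that by (simp add: keys_add_mon add_ac)
qed

lemma in_ideal_if_monomials_multiples:
  fixes I :: "'k::field mpoly set"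
  assumes I: "ideal I (poly_ring n)" and A: "xpow ` A \<subseteq> I" and f: "keys f \<subseteq> multiples n A"
  shows "f \<in> I"
proof -
  have "single m (lookup f m) \<in> I" if "m \<in> keys f" for m
  proof -
    have "m \<in> multiples n A"
      using that f by blast
    then obtain h w where m: "m = h + w" "h \<in> A" "keys w \<subseteq> {..n}"
      by (auto simp: multiples_def)
    have "single m (lookup f m) = single w (lookup f m) * xpow h"
      by (simp add: m(1) xpow_def mult_single add.commute)
    also have "\<dots> \<in> I"
      using m A by (intro ideal_mult[OF I] polys_single) auto
    finally show ?thesis .
  qed
  then show ?thesis
    using ideal_sum[OF I, of "keys f" "\<lambda>m. single m (lookup f m)"] mpoly_eq_sum_singles[of f]
    by simp
qed

lemma Idl_subset:
  assumes "ideal I (poly_ring n)" "X \<subseteq> I"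
  shows "Idl\<^bsub>poly_ring n\<^esub> X \<subseteq> I"
  by (rule ring.genideal_minimal[OF ring_poly_ring assms])

lemma subset_multiples: "A \<subseteq> multiples n A"
  using in_multiplesI[of _ A 0 n] by auto

text \<open>
  The polynomials all of whose monomials are multiples of the generating monomials form an ideal,
  so this ideal contains \<open>I\<close>.
\<close>

lemma xpow_in_monomial_ideal:
  fixes I :: "'k::field mpoly set"
  assumes "monomial_ideal n I" "ideal I (poly_ring n)" "f \<in> I" "m \<in> keys f"
  shows "xpow m \<in> I"
proof -
  obtain A where A: "\<And>m. m \<in> A \<Longrightarrow> keys m \<subseteq> {..n}" and I: "I = Idl\<^bsub>poly_ring n\<^esub> (xpow ` A)"
    using assms(1) by (auto simp: monomial_ideal_def)
  have "I \<subseteq> {f. keys f \<subseteq> multiples n A}"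
    unfolding I using subset_multiples[of A n]
    by (intro Idl_subset ideal_multiples A) (auto simp: xpow_def)
  then have "m \<in> multiples n A"
    using assms(3,4) by blast
  moreover have "xpow ` A \<subseteq> I"
    unfolding I genideal_def by blast
  ultimately show ?thesis
    by (intro in_ideal_if_monomials_multiples[OF assms(2)]) (auto simp: xpow_def)
qed

text \<open>
  An ideal generated in degree $r$ is recovered from its monomials of degree $r$, because the
  monomials of its elements of degree $r$ belong to it.
\<close>

lemma ideal_eq_multiples:
  fixes I :: "'k::field mpoly set"
  assumes mon: "monomial_ideal n I" and hilb: "ideal_in_hilb n p r I"
  shows "I = {f. keys f \<subseteq> multiples n (mons_of n I r)}"
proof
  have I: "ideal I (poly_ring n)" and gen: "I = Idl\<^bsub>poly_ring n\<^esub> (graded_part n I r)"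
    using hilb unfolding ideal_in_hilb_def homogeneous_ideal_def by blast+
  have "graded_part n I r \<subseteq> {f. keys f \<subseteq> multiples n (mons_of n I r)}"
  proof clarify
    fix f m assume "f \<in> graded_part n I r" "m \<in> keys f"
    then have "m \<in> mons_of n I r"
      using xpow_in_monomial_ideal[OF mon I, of f m]
      by (auto simp: graded_part_def forms_def mons_of_def)
    then show "m \<in> multiples n (mons_of n I r)"
      using subset_multiples by blast
  qed
  then have "Idl\<^bsub>poly_ring n\<^esub> (graded_part n I r) \<subseteq> {f. keys f \<subseteq> multiples n (mons_of n I r)}"
    by (intro Idl_subset ideal_multiples) (auto simp: mons_of_def monomials_def)
  then show "I \<subseteq> {f. keys f \<subseteq> multiples n (mons_of n I r)}"
    by (rule ord_eq_le_trans[OF gen])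
  have "xpow ` mons_of n I r \<subseteq> I"
    by (auto simp: mons_of_def)
  then show "{f. keys f \<subseteq> multiples n (mons_of n I r)} \<subseteq> I"
    using in_ideal_if_monomials_multiples[OF I] by blast
qed

lemma borel_set_mons_of:
  assumes "borel_fixed n I"
  shows "borel_set n r (mons_of n I r)"
  unfolding borel_set_def
proof (intro conjI ballI allI impI; (elim conjE)?)
  fix m i j assume m: "m \<in> mons_of n I r" and ij: "i \<in> keys m" "i < j" "j \<le> n"
  let ?m = "m - single i 1 + single j 1"
  have "xpow ?m \<in> I"
    using assms m ij unfolding borel_fixed_def mons_of_def by blast
  moreover have "mdeg ?m = r"
    using m mdeg_move_var[OF ij(1)] by (simp add: mons_of_def monomials_def)
  moreover have "keys ?m \<subseteq> {..n}"
    using m ij(3) keys_minus_subset[of m "single i 1"]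
    by (auto simp: mons_of_def monomials_def keys_add_mon)
  ultimately show "?m \<in> mons_of n I r"
    by (simp add: mons_of_def monomials_def)
qed (auto simp: mons_of_def)

section \<open>Decreasing moves\<close>

lemma lookup_move:
  assumes "admissible g m"
  shows "int (lookup (move g m) k) = lookup g k + int (lookup m k)"
  using assms[unfolded admissible_def, rule_format, of k]
  by (simp add: move_def int_exp_def Poly_Mapping.map.rep_eq lookup_add when_def split: if_splits)

text \<open>
  A product of powers of the moves $e^-_k$ carries $c_k$ factors from $x_k$ to $x_{k-1}$, so that
  $x_k$ gains $c_{k+1}$ and loses $c_k$.
\<close>

lemma decreasing_move_transfer:
  assumes g: "g = 0 \<or> (\<exists>lam :: nat \<Rightarrow> nat. g = (\<Sum>l\<in>{1..j}. single (l - 1) (int (lam l)) - single l (int (lam l))))"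
  obtains c :: "nat \<Rightarrow> nat" where "c 0 = 0" "\<And>k. j < k \<Longrightarrow> c k = 0"
    "\<And>m k. admissible g m \<Longrightarrow> lookup (move g m) k + c k = lookup m k + c (Suc k)"
proof -
  have "\<exists>c :: nat \<Rightarrow> nat. c 0 = 0 \<and> (\<forall>k>j. c k = 0) \<and> (\<forall>k. lookup g k = int (c (Suc k)) - int (c k))"
    using g
  proof
    assume "g = 0"
    then show ?thesis
      by (intro exI[of _ "\<lambda>_. 0"]) simp
  next
    assume "\<exists>lam :: nat \<Rightarrow> nat. g = (\<Sum>l\<in>{1..j}. single (l - 1) (int (lam l)) - single l (int (lam l)))"
    then obtain lam :: "nat \<Rightarrow> nat" where
      g: "g = (\<Sum>l\<in>{1..j}. single (l - 1) (int (lam l)) - single l (int (lam l)))"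
      by blast
    define c where "c k = (if k \<in> {1..j} then lam k else 0)" for k
    have "lookup g k = int (c (Suc k)) - int (c k)" for k
    proof -
      have "lookup g k = (\<Sum>l\<in>{1..j}. (if l = Suc k then int (lam (Suc k)) else 0) -
          (if l = k then int (lam k) else 0))"
        unfolding g lookup_sum
        by (intro sum.cong) (auto simp: lookup_minus lookup_single when_def)
      then show ?thesis
        by (simp add: sum_subtractf c_def)
    qed
    then show ?thesis
      by (intro exI[of _ c]) (simp add: c_def)
  qed
  then obtain c :: "nat \<Rightarrow> nat" where c: "c 0 = 0" "\<And>k. j < k \<Longrightarrow> c k = 0"
    "\<And>k. lookup g k = int (c (Suc k)) - int (c k)"
    by blast
  show thesis
  proof (rule that)
    show "c 0 = 0" "\<And>k. j < k \<Longrightarrow> c k = 0"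
      by (fact c)+
    show "lookup (move g m) k + c k = lookup m k + c (Suc k)" if "admissible g m" for m k
      using lookup_move[OF that, of k] c(3)[of k] by linarith
  qed
qed

text \<open>
  A decreasing move can be undone by increasing ones inside a Borel set.  The factors carried out
  of the variable $x_l$ with the lowest index are moved back first: they are still present
  in $x_{l-1}$, since nothing was carried out of $x_{l-1}$.
\<close>

lemma borel_set_increasing:
  assumes B: "borel_set n r B" and "j \<le> n" and "h \<in> B"
    and "c 0 = 0" "\<And>k. j < k \<Longrightarrow> c k = 0"
    and "\<And>k. lookup h k + c k = lookup m k + c (Suc k)"
  shows "m \<in> B"
  using assms(3-)
proof (induction "\<Sum>k\<le>j. c k" arbitrary: h c rule: less_induct)
  case less
  show ?case
  proof (cases "\<forall>k. c k = 0")
    case True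
    then have "h = m"
      using less.prems(4) by (intro poly_mapping_eqI) simp
    then show ?thesis
      using less.prems(1) by simp
  next
    case False
    then obtain l where l: "c l \<noteq> 0" "\<And>k. k < l \<Longrightarrow> c k = 0"
      using exists_least_iff[of "\<lambda>k. c k \<noteq> 0"] by blast
    have "l \<noteq> 0"
      by (cases "l = 0") (use l(1) less.prems(2) in simp_all)
    then obtain i where i: "l = Suc i"
      using not0_implies_Suc by blast
    have "l \<le> j"
      using l(1) less.prems(3)[of l] by (cases "j < l") simp_all
    have "c i = 0" "c (Suc i) \<noteq> 0"
      using l(1) l(2)[of i] unfolding i by simp_all
    then have pos: "0 < lookup h i"
      using less.prems(4)[of i] by linarith
    then have key: "i \<in> keys h"
      unfolding in_keys_iff by simp
    let ?h = "h - single i 1 + single l 1" and ?c = "c(l := c l - 1)"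
    show ?thesis
    proof (rule less.hyps[of ?c ?h])
      show "(\<Sum>k\<le>j. ?c k) < (\<Sum>k\<le>j. c k)"
        by (rule sum_strict_mono_ex1) (use l(1) \<open>l \<le> j\<close> in auto)
      show "?h \<in> B"
        using B less.prems(1) key i \<open>l \<le> j\<close> \<open>j \<le> n\<close> unfolding borel_set_def by simp
      show "lookup ?h k + ?c k = lookup m k + ?c (Suc k)" for k
        using less.prems(4)[of k] \<open>c i = 0\<close> \<open>c (Suc i) \<noteq> 0\<close> pos
        by (auto simp: i lookup_add lookup_minus lookup_single when_def)
    qed (use less.prems in auto)
  qed
qed

text \<open>
  If $h$ had none of the variables $x_0,\ldots,x_i$, then $c_k = 0$ would hold for all $k \le i$
  by induction, since a variable without remaining factors has lost as much as it had and gained;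
  but $x_i$ has lost at least one factor.
\<close>

lemma key_le_if_decreasing:
  assumes eq: "\<And>k. lookup h k + c k = lookup m k + c (Suc k)" and "c 0 = (0 :: nat)" and "i \<in> keys m"
  shows "\<exists>k\<in>keys h. k \<le> i"
proof (rule ccontr)
  assume *: "\<not> ?thesis"
  then have zero: "lookup h k = 0" if "k \<le> i" for k
    using that by (auto simp: in_keys_iff)
  have "k \<le> i \<Longrightarrow> c k = 0" for k
  proof (induction k)
    case (Suc k)
    then show ?case
      using eq[of k] zero[of k] by simp
  qed (use assms in simp)
  then show False
    using eq[of i] zero[of i] \<open>i \<in> keys m\<close> by (simp add: in_keys_iff)
qed

lemma below_transfer:
  assumes "below w h" "\<And>k. k < i \<Longrightarrow> lookup h k = lookup h' k" "l \<in> keys h" "l \<le> i"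
  shows "below w h'"
  unfolding below_def
proof (intro ballI)
  fix k j assume k: "k \<in> keys w" and j: "j \<in> keys h'"
  show "k \<le> j"
  proof (cases "j < i")
    case True
    then show ?thesis
      using assms(1,2) k j by (auto simp: below_def in_keys_iff)
  next
    case False
    have "k \<le> l"
      using assms(1,3) k by (auto simp: below_def)
    with False assms(4) show ?thesis by simp
  qed
qed

text \<open>The monomial $1$ has to be excluded: its \<open>min_var\<close> is the minimum of the empty set.\<close>

lemma min_var_level:
  assumes "m \<in> part_ge S i - part_ge S (i + 1)" "m \<noteq> 0"
  shows "i \<in> keys m" and "k < i \<Longrightarrow> lookup m k = 0"
proof -
  have "keys m \<noteq> {}"
    using assms(2) by (metis ex_in_conv in_keys_iff lookup_zero poly_mapping_eqI)
  moreover have min: "min_var m = i"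
    using assms(1) by (auto simp: part_ge_def)
  ultimately show "i \<in> keys m"
    using Min_in[of "keys m"] by (simp add: min_var_def)
  show "lookup m k = 0" if "k < i"
  proof (rule ccontr)
    assume "lookup m k \<noteq> 0"
    then have "min_var m \<le> k"
      by (simp add: min_var_def in_keys_iff)
    with min that show False
      by simp
  qed
qed

lemma multiples_diffE:
  assumes "borel_set n r B" "m \<in> multiples n B - multiples n B'"
  obtains h w where "h \<in> B - B'" "keys w \<subseteq> {..n}" "below w h" "m = h + w"
proof -
  obtain h w where hw: "h \<in> B" "keys w \<subseteq> {..n}" "below w h" "m = h + w"
    using in_multiplesE[OF assms(1)] assms(2) by blast
  moreover have "h \<notin> B'"
    using hw in_multiplesI[of h B' w n] assms(2) by blast
  ultimately show thesis
    using that by blast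
qed

text \<open>
  Since $b$ is not in the Borel set $B$, neither is any $F(x^b)$.  Therefore \<open>B - B'\<close> and
  \<open>B' - B\<close> consist precisely of the $F(x^a)$ and of the $F(x^b)$.  That both can be multiplied
  by the same $w$ in the decomposition of Eliahou and Kervaire is the fact \<open>below\<close> in the
  proof: $F(x^a)$ and $F(x^b)$ agree in all variables before $x_i$, and both contain a variable
  with index at most $i$.
\<close>

lemma
  fixes n r i :: nat and B B' :: "mon set" and a b :: mon
  defines "D \<equiv> decreasing_moves B i a"
  assumes B: "borel_set n r B" and B': "borel_set n r B'" and "i < n"
    and a_min: "a \<in> min_elems n r B i" and b_max: "b \<in> max_elems n r B i"
    and consistent: "borel_consistent n B i a b"
    and B'_eq: "B' = (B \<union> (\<lambda>g. move g b) ` D) - (\<lambda>g. move g a) ` D"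
  shows monomial_exchange_borel:
      "monomial_exchange n r (multiples n B) (multiples n B') a b"
    and multiples_not_subset: "\<not> multiples n B \<subseteq> multiples n B'"
proof -
  have a: "a \<in> B" "a \<in> part_ge B i - part_ge B (i + 1)"
    using a_min by (auto simp: min_elems_def part_ge_def)
  have b: "b \<in> monomials n r" "b \<notin> B"
    "b \<in> part_ge (monomials n r - B) i - part_ge (monomials n r - B) (i + 1)"
    using b_max by (auto simp: max_elems_def part_ge_def)
  have B_sub: "B \<subseteq> monomials n r"
    using B by (simp add: borel_set_def)
  have deg: "mdeg a = r" "mdeg b = r"
    using a(1) b(1) B_sub by (auto simp: monomials_def)
  \<comment> \<open>If \<open>r = 0\<close>, then \<open>a\<close> and \<open>b\<close> are both \<open>1\<close>, but only \<open>a\<close> is in \<open>B\<close>.\<close>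
  have "a \<noteq> 0" "b \<noteq> 0"
    using deg a(1) b(2) by (metis mdeg_zero mdeg_eq_0_iff)+
  note a_level = min_var_level[OF a(2) \<open>a \<noteq> 0\<close>] and b_level = min_var_level[OF b(3) \<open>b \<noteq> 0\<close>]
  have move_0: "move 0 m = m" "admissible 0 m" for m
    by (auto intro!: poly_mapping_eqI
        simp: move_def admissible_def int_exp_def Poly_Mapping.map.rep_eq when_def)
  have D: "admissible g a" "move g a \<in> B" "admissible g b" if "g \<in> D" for g
    using that consistent a(1) move_0
    by (auto simp: D_def decreasing_moves_def borel_consistent_def)
  have D_cases: "g = 0 \<or> (\<exists>lam :: nat \<Rightarrow> nat. g = (\<Sum>l\<in>{1..i}. single (l - 1) (int (lam l)) - single l (int (lam l))))"
    if "g \<in> D" for g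
    using that by (auto simp: D_def decreasing_moves_def)
  have shift: "\<exists>c :: nat \<Rightarrow> nat. c 0 = 0 \<and> (\<forall>k>i. c k = 0) \<and>
      (\<forall>k. lookup (move g a) k + c k = lookup a k + c (Suc k)) \<and>
      (\<forall>k. lookup (move g b) k + c k = lookup b k + c (Suc k))" if "g \<in> D" for g
    by (rule decreasing_move_transfer[OF D_cases[OF that]]) (use D(1,3)[OF that] in blast)
  have move_b: "move g b \<notin> B" if g: "g \<in> D" for g
  proof
    assume "move g b \<in> B"
    obtain c :: "nat \<Rightarrow> nat" where "c 0 = 0" "\<forall>k>i. c k = 0"
      "\<forall>k. lookup (move g b) k + c k = lookup b k + c (Suc k)"
      using shift[OF g] by (elim exE conjE)
    then have "b \<in> B"
      using borel_set_increasing[OF B less_imp_le[OF \<open>i < n\<close>] \<open>move g b \<in> B\<close>, of c b] by simp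
    with b(2) show False by simp
  qed
  have diff: "B - B' = (\<lambda>g. move g a) ` D" "B' - B = (\<lambda>g. move g b) ` D"
  proof -
    have "B - (B \<union> E - A) = A" "B \<union> E - A - B = E" if "A \<subseteq> B" "E \<inter> B = {}" for A E
      using that by blast+
    moreover have "(\<lambda>g. move g a) ` D \<subseteq> B" "(\<lambda>g. move g b) ` D \<inter> B = {}"
      using D(2) move_b by auto
    ultimately show "B - B' = (\<lambda>g. move g a) ` D" "B' - B = (\<lambda>g. move g b) ` D"
      unfolding B'_eq by metis+
  qed
  have swap: "move g a + b = move g b + a" if "g \<in> D" for g
  proof (rule poly_mapping_eqI)
    show "lookup (move g a + b) k = lookup (move g b + a) k" for k
      unfolding lookup_add
      using lookup_move[OF D(1)[OF that], of k] lookup_move[OF D(3)[OF that], of k] by linarith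
  qed
  have below: "below w (move g a) \<longleftrightarrow> below w (move g b)" if g: "g \<in> D" for g w
  proof -
    obtain c :: "nat \<Rightarrow> nat" where c: "c 0 = 0"
      "\<forall>k. lookup (move g a) k + c k = lookup a k + c (Suc k)"
      "\<forall>k. lookup (move g b) k + c k = lookup b k + c (Suc k)"
      using shift[OF g] by (elim exE conjE)
    have agree: "lookup (move g a) k = lookup (move g b) k" if "k < i" for k
      using c(2)[rule_format, of k] c(3)[rule_format, of k] a_level(2)[OF that] b_level(2)[OF that]
      by linarith
    obtain k where k: "k \<in> keys (move g a)" "k \<le> i"
      using key_le_if_decreasing[OF c(2)[rule_format] c(1) a_level(1)] by (elim bexE)
    moreover obtain l where l: "l \<in> keys (move g b)" "l \<le> i"
      using key_le_if_decreasing[OF c(3)[rule_format] c(1) b_level(1)] by (elim bexE)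
    ultimately show ?thesis
      using below_transfer[of w "move g a" i "move g b" k]
        below_transfer[of w "move g b" i "move g a" l] agree by auto
  qed
  have head: "h + w \<in> multiples n S \<longleftrightarrow> h \<in> S"
    if "borel_set n r S" "h \<in> B \<union> B'" "keys w \<subseteq> {..n}" "below w h" for S h w
    using multiples_iff_head[OF that(1) _ that(3,4)] that(2) B_sub B' by (auto simp: borel_set_def)
  show "monomial_exchange n r (multiples n B) (multiples n B') a b"
  proof
    show "saturated_monomials n r (multiples n B)" "saturated_monomials n r (multiples n B')"
      using saturated_multiples B B' by blast+
    show "mdeg a = mdeg b"
      using deg by simp
  next
    fix m assume "m \<in> multiples n B - multiples n B'"
    then obtain h w where hw: "h \<in> B - B'" "keys w \<subseteq> {..n}" "below w h" "m = h + w"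
      using multiples_diffE[OF B] by blast
    then obtain g where g: "g \<in> D" "h = move g a"
      using diff by blast
    then have "move g b \<in> B' - B" "below w (move g b)"
      using diff below[of g w] hw by auto
    then have "move g b + w \<in> multiples n B' - multiples n B"
      using head[OF B _ hw(2)] head[OF B' _ hw(2)] by blast
    moreover have "m + b = (move g b + w) + a"
      using swap[OF g(1)] hw(4) g(2) by (metis add.assoc add.commute)
    ultimately show "\<exists>m'\<in>multiples n B' - multiples n B. m + b = m' + a"
      by blast
  next
    fix m' assume "m' \<in> multiples n B' - multiples n B"
    then obtain h w where hw: "h \<in> B' - B" "keys w \<subseteq> {..n}" "below w h" "m' = h + w"
      using multiples_diffE[OF B'] by blast
    then obtain g where g: "g \<in> D" "h = move g b"
      using diff by blast
    then have "move g a \<in> B - B'" "below w (move g a)"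
      using diff below[of g w] hw by auto
    then have "move g a + w \<in> multiples n B - multiples n B'"
      using head[OF B _ hw(2)] head[OF B' _ hw(2)] by blast
    moreover have "(move g a + w) + b = m' + a"
      using swap[OF g(1)] hw(4) g(2) by (metis add.assoc add.commute)
    ultimately show "\<exists>m\<in>multiples n B - multiples n B'. m + b = m' + a"
      by blast
  qed
  have "0 \<in> D"
    by (simp add: D_def decreasing_moves_def)
  then have "a \<in> B - B'"
    using diff(1) move_0(1)[of a] by (metis imageI)
  moreover have "a + 0 \<in> multiples n B \<longleftrightarrow> a \<in> B" "a + 0 \<in> multiples n B' \<longleftrightarrow> a \<in> B'"
    using head[OF B, of a 0] head[OF B', of a 0] a(1) by (simp_all add: below_def)
  ultimately show "\<not> multiples n B \<subseteq> multiples n B'"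
    by auto
qed

theorem theorem4p7:
  fixes n r i :: nat and p :: "rat poly"
    and I J :: "'k::{alg_closed_field, field_char_0} mpoly set"
    and a b :: mon
  assumes "gotzmann_number TYPE('k) n p = ereal (real r)"
    and "borel_fixed n I" and "ideal_in_hilb n p r I"
    and "borel_fixed n J" and "ideal_in_hilb n p r J"
    and "i < n"
    and "a \<in> min_elems n r (mons_of n I r) i"
    and "b \<in> max_elems n r (mons_of n I r) i"
    and "borel_consistent n (mons_of n I r) i a b"
    and "mons_of n J r =
      (mons_of n I r \<union> (\<lambda>g. move g b) ` decreasing_moves (mons_of n I r) i a) -
        (\<lambda>g. move g a) ` decreasing_moves (mons_of n I r) i a"
  shows "\<exists>C. rational_curve n p r C \<and>
    hilb_point n I \<in> C ` proj_line \<and> hilb_point n J \<in> C ` proj_line"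
proof -
  let ?M = "multiples n (mons_of n I r)" and ?N = "multiples n (mons_of n J r)"
  note borel = borel_set_mons_of[OF assms(2)] borel_set_mons_of[OF assms(4)]
  have I: "I = {f. keys f \<subseteq> ?M}" and J: "J = {f. keys f \<subseteq> ?N}"
    using assms(2,4) ideal_eq_multiples[OF _ assms(3)] ideal_eq_multiples[OF _ assms(5)]
    unfolding borel_fixed_def by blast+
  have p: "has_hilbert_poly n {f :: 'k mpoly. keys f \<subseteq> ?M} p"
    unfolding I[symmetric] using assms(3) unfolding ideal_in_hilb_def by blast
  have "\<exists>C. rational_curve n p r C \<and>
      saturation n {f :: 'k mpoly. keys f \<subseteq> ?M} \<in> C ` proj_line \<and>
      saturation n {f :: 'k mpoly. keys f \<subseteq> ?N} \<in> C ` proj_line"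
    by (rule monomial_exchange.rational_curve_exchange[OF
          monomial_exchange_borel[OF borel assms(6-10)] p multiples_not_subset[OF borel assms(6-10)]])
  then show ?thesis
    unfolding hilb_point_def I[symmetric] J[symmetric] .
qed

end
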